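(* With the notation of the context, the two models $\hat{\mathcal J}_{\text{TDnum}}$ and $\hat{\mathcal J}_{\text{SMWapprox}}$ (built at the expansion point $\boldsymbol\lambda\in[\underline\lambda,\overline\lambda]^m$, with the same truncated mesh and finite element space) coincide, i.e. $$\hat{\mathcal J}_{\text{TDnum}}(\boldsymbol\eta)=\hat{\mathcal J}_{\text{SMWapprox}}(\boldsymbol\eta)\qquad\text{for all }\boldsymbol\eta\in[\underline\lambda,\overline\lambda]^m.$$
   Context: Physical problem: Let $0<\underline\lambda<\overline\lambda$ and $\mathsf D=(0,1)^2$ with boundary $\partial\mathsf D=\Gamma_D\cup\Gamma_N$ (disjoint, $|\Gamma_D|>0$). Let $\mathcal T=\{T_1,\dots,T_m\}$ be the structured mesh of $\mathsf D$ obtained from a uniform square grid of width $h$ by cutting each square along the diagonal from bottom left to top right. Every element is $T_\ell=\mathbf z_\ell+h\hat T$, where $\mathbf z_\ell$ is its centroid and $\hat T=\hat T^{(1)}$ (type 1, vertices $\frac13(-2,-1)^\top,\frac13(1,-1)^\top,\frac13(1,2)^\top$) or $\hat T=\hat T^{(2)}$ (type 2, vertices $\frac13(2,1)^\top,\frac13(-1,-2)^\top,\frac13(-1,1)^\top$). For each $\ell$, $\hat T$ below is the reference triangle of the type of $T_\ell$. For $\boldsymbol\lambda\in[\underline\lambda,\overline\lambda]^m$ (the material value in $T_\ell$ is $\boldsymbol\lambda_\ell$), let $\mathbf K(\boldsymbol\lambda)$ and $\mathbf f$ be the (invertible) stiffness matrix and load vector of the piecewise linear finite element discretization of the heat equation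 $-\operatorname{div}(\lambda\nabla u)=f$ in $\mathsf D$, with $u=0$ on $\Gamma_D$ and $\lambda\,\partial_n u=g_N$ on $\Gamma_N$. Let $u_h$ be the discrete solution with coefficient vector $\mathbf K(\boldsymbol\lambda)^{-1}\mathbf f$, and $\mathcal J(\boldsymbol\lambda)=\mathbf f^\top\mathbf K(\boldsymbol\lambda)^{-1}\mathbf f$. Truncated domain and sectors: For each of the two reference triangles, $B_R(0)\subset\mathbb R^2$ is the truncated domain of radius $R$ (understood as the polygonal domain covered by its mesh), containing the closure of $\hat T$. It has a conforming triangular mesh $\{\tau_1,\dots,\tau_M\}$ in which $\hat T$ is exactly one element, and $$V_h^R=\{v\in C^0(\overline{B_R(0)}):v|_{\partial B_R(0)}=0,\ v|_{\tau_i}\text{ affine linear}, i=1,\dots,M\}.$$ The part of $B_R(0)$ outside $\hat T$ is divided into three sectors $S_1,S_2,S_3$ by the three lines halving the interior angles of $\hat T$ (the rays from the incenter of $\hat T$ through its vertices), in a fixed numbering. Sector values: For each $\ell$ and $j=1,2,3$, $$\lambda^{S_j}_{T_\ell}=\Big(\sum_{T\in\mathcal N(T_\ell)}w_{S_j,T}(\boldsymbol\lambda_T)^\alpha\Big)^{1/\alpha}.$$ Here $\mathcal N(T_\ell)$ is the set of triangles of $\mathcal T$ having at least one common vertex with $T_\ell$, $\boldsymbol\lambda_T$ is the entry of $\boldsymbol\lambda$ for triangle $T$, $w_{S_j,T}=|T\cap S_j|/|T|$ is the volume fraction of $T$ in sector $S_j$ (after the rescaling $x\mapsto(x-\mathbf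 z_\ell)/h$), and $\alpha\ne0$ is a fixed parameter ($\alpha=-0.5$ in the paper). These values are assumed to be well-defined positive numbers. Write $\Lambda_\ell=(\boldsymbol\lambda_\ell,\lambda^{S_1}_{T_\ell},\lambda^{S_2}_{T_\ell},\lambda^{S_3}_{T_\ell})$. Discrete correctors: Let $\mathbf e^{(1)},\mathbf e^{(2)}$ be the unit vectors of $\mathbb R^2$. For $\eta\in[\underline\lambda,\overline\lambda]$ and $k=1,2$, $K_{\hat T,h}[\Lambda_\ell,\eta;\mathbf e^{(k)}]\in V_h^R$ is the unique solution of $$\int_{B_R(0)}\Big(\chi_{\hat T}\,\eta+\sum_{j=1}^3\chi_{S_j}\lambda^{S_j}_{T_\ell}\Big)\nabla K_{\hat T,h}[\Lambda_\ell,\eta;\mathbf e^{(k)}]\cdot\nabla\psi_h\,dx=-(\eta-\boldsymbol\lambda_\ell)\int_{\hat T}\mathbf e^{(k)}\cdot\nabla\psi_h\,dx\quad\forall\psi_h\in V_h^R,$$ and $W_{\hat T,h}[\Lambda_\ell;\mathbf e^{(k)}]\in V_h^R$ is the unique solution of $$\int_{B_R(0)}\Big(\chi_{\hat T}\,\boldsymbol\lambda_\ell+\sum_{j=1}^3\chi_{S_j}\lambda^{S_j}_{T_\ell}\Big)\nabla W_{\hat T,h}[\Lambda_\ell;\mathbf e^{(k)}]\cdot\nabla\psi_h\,dx=-\int_{\hat T}\mathbf e^{(k)}\cdot\nabla\psi_h\,dx\quad\forall\psi_h\in V_h^R.$$ Define the $2\times2$ matrices $\mathcal P_{\hat T,h}[\Lambda_\ell,\eta]$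 and $\mathbf\Gamma_{\hat T,\ell}$ whose $k$-th columns are $\frac1{|\hat T|}\int_{\hat T}\nabla K_{\hat T,h}[\Lambda_\ell,\eta;\mathbf e^{(k)}]\,dx$ and $\frac1{|\hat T|}\int_{\hat T}\nabla W_{\hat T,h}[\Lambda_\ell;\mathbf e^{(k)}]\,dx$, respectively. Models: $$\hat{\mathcal J}_{\text{TDnum}}(\boldsymbol\eta)=\mathcal J(\boldsymbol\lambda)-\sum_{\ell=1}^m|T_\ell|(\boldsymbol\eta_\ell-\boldsymbol\lambda_\ell)(\nabla u_h|_{T_\ell})^\top\left(\mathbf I_2+\mathcal P_{\hat T,h}[\Lambda_\ell,\boldsymbol\eta_\ell]\right)\nabla u_h|_{T_\ell},$$ $$\hat{\mathcal J}_{\text{SMWapprox}}(\boldsymbol\eta)=\mathcal J(\boldsymbol\lambda)-\sum_{\ell=1}^m|T_\ell|(\boldsymbol\eta_\ell-\boldsymbol\lambda_\ell)(\nabla u_h|_{T_\ell})^\top\left(\mathbf I_2-(\boldsymbol\eta_\ell-\boldsymbol\lambda_\ell)\mathbf\Gamma_{\hat T,\ell}\right)^{-1}\nabla u_h|_{T_\ell}.$$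
   Formalization: For elements with an edge on the boundary of the domain, the sector beyond that edge meets no mesh triangle, so the sum defining the sector value is 0 and cannot yield a positive number; the formal version keeps the formula where the sum is positive and allows any positive value otherwise. *)

theory Defs
  imports "HOL-Analysis.Analysis"
begin

section \<open>Piecewise linear finite elements on triangular meshes\<close>

text \<open>Elements are closed triangles.  The polygonal domain covered by a mesh \<open>M\<close> is the open set
  \<^term>\<open>interior (\<Union>M)\<close>, whose closure is \<^term>\<open>\<Union>M\<close>.  Boundaries of elements are Lebesgue null
  sets, so integrals do not depend on whether elements and domains are taken open or closed.\<close>

definition conforming_mesh :: "(real^2) set set \<Rightarrow> bool" where
  "conforming_mesh M \<longleftrightarrow> triangulation M \<and> (\<forall>\<tau>\<in>M. 2 simplex \<tau>)"

abbreviation mesh_domain :: "(real^2) set set \<Rightarrow> (real^2) set" where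
  "mesh_domain M \<equiv> interior (\<Union>M)"

definition vertices :: "(real^2) set \<Rightarrow> (real^2) set" where
  "vertices T = {x. x extreme_point_of T}"

definition affine_linear_on :: "(real^2) set \<Rightarrow> (real^2 \<Rightarrow> real) \<Rightarrow> bool" where
  "affine_linear_on T v \<longleftrightarrow> (\<exists>g c. \<forall>x\<in>T. v x = g \<bullet> x + c)"

text \<open>A function on \<^term>\<open>\<Union>M\<close> is represented by its extension by zero to the whole plane; this is
  what makes solutions of variational problems unique as HOL functions.\<close>

definition P1_space :: "(real^2) set set \<Rightarrow> (real^2 \<Rightarrow> real) set" where
  "P1_space M = {v. continuous_on (\<Union>M) v \<and> (\<forall>\<tau>\<in>M. affine_linear_on \<tau> v) \<and> (\<forall>x. x \<notin> \<Union>M \<longrightarrow> v x = 0)}"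

definition P1_space_zero :: "(real^2) set set \<Rightarrow> (real^2 \<Rightarrow> real) set" where
  "P1_space_zero M = {v \<in> P1_space M. \<forall>x\<in>frontier (mesh_domain M). v x = 0}"

definition mesh_nodes :: "(real^2) set set \<Rightarrow> (real^2) set" where
  "mesh_nodes M = (\<Union>\<tau>\<in>M. vertices \<tau>)"

definition nodal_basis :: "(real^2) set set \<Rightarrow> real^2 \<Rightarrow> real^2 \<Rightarrow> real" where
  "nodal_basis M p = (THE v. v \<in> P1_space M \<and> (\<forall>q\<in>mesh_nodes M. v q = (if q = p then 1 else 0)))"

text \<open>The gradient of a \<open>P1\<close> function is meaningful off the (null) union of the element boundaries.\<close>

definition grad :: "(real^2 \<Rightarrow> real) \<Rightarrow> real^2 \<Rightarrow> real^2" where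
  "grad v x = (THE D. GDERIV v x :> D)"

section \<open>The structured mesh of the unit square\<close>

abbreviation unit_square :: "(real^2) set" where
  "unit_square \<equiv> box 0 1"

datatype ttype = Type1 | Type2

primrec ref_vertex :: "ttype \<Rightarrow> (real^2)^3" where
  "ref_vertex Type1 = (1/3) *\<^sub>R vector [vector [-2, -1], vector [1, -1], vector [1, 2]]"
| "ref_vertex Type2 = (1/3) *\<^sub>R vector [vector [2, 1], vector [-1, -2], vector [-1, 1]]"

definition ref_triangle :: "ttype \<Rightarrow> (real^2) set" where
  "ref_triangle s = convex hull (range (\<lambda>j. ref_vertex s $ j))"

text \<open>The grid has \<open>n\<close> by \<open>n\<close> squares of width \<open>h = 1/n\<close>.  The two triangles of the square with
  bottom left corner \<open>(i h, j h)\<close> have the indices \<open>(Type1, i, j)\<close> (below the diagonal) and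
  \<open>(Type2, i, j)\<close> (above it).  These triples replace the numbers \<open>1, \<dots>, m\<close>, where \<open>m = 2 n^2\<close>;
  coefficient vectors are functions of which only the values on \<open>elements n\<close> matter.\<close>

type_synonym element = "ttype \<times> nat \<times> nat"

definition elements :: "nat \<Rightarrow> element set" where
  "elements n = {(s, i, j). i < n \<and> j < n}"

abbreviation elem_type :: "element \<Rightarrow> ttype" where
  "elem_type \<equiv> fst"

fun centroid :: "nat \<Rightarrow> element \<Rightarrow> real^2" where
  "centroid n (Type1, i, j) = (1 / real n) *\<^sub>R vector [real i + 2/3, real j + 1/3]"
| "centroid n (Type2, i, j) = (1 / real n) *\<^sub>R vector [real i + 1/3, real j + 2/3]"

definition triangle :: "nat \<Rightarrow> element \<Rightarrow> (real^2) set" where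
  "triangle n l = (\<lambda>x. centroid n l + (1 / real n) *\<^sub>R x) ` ref_triangle (elem_type l)"

definition structured_mesh :: "nat \<Rightarrow> (real^2) set set" where
  "structured_mesh n = triangle n ` elements n"

lemma triangle_eq_convex_hull:
  "triangle n (Type1, i, j) = convex hull ((\<lambda>x. (1 / real n) *\<^sub>R x) `
     {vector [real i, real j], vector [real i + 1, real j], vector [real i + 1, real j + 1]})"
  "triangle n (Type2, i, j) = convex hull ((\<lambda>x. (1 / real n) *\<^sub>R x) `
     {vector [real i + 1, real j + 1], vector [real i, real j], vector [real i, real j + 1]})"
proof -
  have U: "range F = {F 1, F 2, F 3}" for F :: "3 \<Rightarrow> real^2"
    by (auto simp: UNIV_3)
  have eq: "convex hull {a, b, c} = convex hull {a', b', c'}"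
    if "a = a'" "b = b'" "c = c'" for a b c a' b' c' :: "real^2"
    using that by simp
  show "triangle n (Type1, i, j) = convex hull ((\<lambda>x. (1 / real n) *\<^sub>R x) `
     {vector [real i, real j], vector [real i + 1, real j], vector [real i + 1, real j + 1]})"
    unfolding triangle_def ref_triangle_def convex_hull_affinity[symmetric] U image_insert image_empty
    by (rule eq) (simp_all add: vec_eq_iff forall_2 add_divide_distrib diff_divide_distrib)
  show "triangle n (Type2, i, j) = convex hull ((\<lambda>x. (1 / real n) *\<^sub>R x) `
     {vector [real i + 1, real j + 1], vector [real i, real j], vector [real i, real j + 1]})"
    unfolding triangle_def ref_triangle_def convex_hull_affinity[symmetric] U image_insert image_empty
    by (rule eq) (simp_all add: vec_eq_iff forall_2 add_divide_distrib diff_divide_distrib)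
qed

section \<open>Boundary measure and boundary integrals on the unit square\<close>

text \<open>Arc length parametrizations of the four sides; a boundary part is measured side by side.\<close>

definition sides :: "(real \<Rightarrow> real^2) set" where
  "sides = {\<lambda>t. vector [t, 0], \<lambda>t. vector [1, t], \<lambda>t. vector [t, 1], \<lambda>t. vector [0, t]}"

definition side_params :: "(real \<Rightarrow> real^2) \<Rightarrow> (real^2) set \<Rightarrow> real set" where
  "side_params \<gamma> A = {t \<in> {0..1}. \<gamma> t \<in> A}"

definition boundary_measurable :: "(real^2) set \<Rightarrow> bool" where
  "boundary_measurable A \<longleftrightarrow> (\<forall>\<gamma>\<in>sides. side_params \<gamma> A \<in> sets lebesgue)"

definition boundary_length :: "(real^2) set \<Rightarrow> real" where
  "boundary_length A = (\<Sum>\<gamma>\<in>sides. measure lebesgue (side_params \<gamma> A))"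

definition boundary_integrable :: "(real^2) set \<Rightarrow> (real^2 \<Rightarrow> real) \<Rightarrow> bool" where
  "boundary_integrable A g \<longleftrightarrow> (\<forall>\<gamma>\<in>sides. set_integrable lebesgue (side_params \<gamma> A) (\<lambda>t. g (\<gamma> t)))"

definition boundary_integral :: "(real^2) set \<Rightarrow> (real^2 \<Rightarrow> real) \<Rightarrow> real" where
  "boundary_integral A g = (\<Sum>\<gamma>\<in>sides. LINT t:side_params \<gamma> A|lebesgue. g (\<gamma> t))"

section \<open>Discretization of the heat equation\<close>

text \<open>\<open>GD\<close>, \<open>GN\<close>: Dirichlet and Neumann boundary; \<open>f\<close>, \<open>gN\<close>: source and Neumann data;
  \<open>lam\<close>: coefficient vector.  The degrees of freedom are the nodes whose basis function
  satisfies the homogeneous Dirichlet condition.\<close>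

abbreviation hat :: "nat \<Rightarrow> real^2 \<Rightarrow> real^2 \<Rightarrow> real" where
  "hat n \<equiv> nodal_basis (structured_mesh n)"

definition free_nodes :: "nat \<Rightarrow> (real^2) set \<Rightarrow> (real^2) set" where
  "free_nodes n GD = {p \<in> mesh_nodes (structured_mesh n). \<forall>x\<in>GD. hat n p x = 0}"

definition stiffness :: "nat \<Rightarrow> (element \<Rightarrow> real) \<Rightarrow> real^2 \<Rightarrow> real^2 \<Rightarrow> real" where
  "stiffness n lam p q =
     (\<Sum>l\<in>elements n. lam l * (LINT x:triangle n l|lebesgue. grad (hat n p) x \<bullet> grad (hat n q) x))"

definition load :: "nat \<Rightarrow> (real^2) set \<Rightarrow> (real^2 \<Rightarrow> real) \<Rightarrow> (real^2 \<Rightarrow> real) \<Rightarrow> real^2 \<Rightarrow> real" where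
  "load n GN f gN p = (LINT x:unit_square|lebesgue. f x * hat n p x)
     + boundary_integral GN (\<lambda>x. gN x * hat n p x)"

text \<open>Inverse of a square matrix with rows and columns indexed by a finite set \<open>I\<close>, padded by zeros.\<close>

definition matrix_inv_on :: "'i set \<Rightarrow> ('i \<Rightarrow> 'i \<Rightarrow> real) \<Rightarrow> 'i \<Rightarrow> 'i \<Rightarrow> real" where
  "matrix_inv_on I A = (THE B.
     (\<forall>p\<in>I. \<forall>q\<in>I. (\<Sum>r\<in>I. A p r * B r q) = (if p = q then 1 else 0)) \<and>
     (\<forall>p\<in>I. \<forall>q\<in>I. (\<Sum>r\<in>I. B p r * A r q) = (if p = q then 1 else 0)) \<and>
     (\<forall>p q. p \<notin> I \<or> q \<notin> I \<longrightarrow> B p q = 0))"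

definition u_coeff :: "nat \<Rightarrow> (real^2) set \<Rightarrow> (real^2) set \<Rightarrow> (real^2 \<Rightarrow> real) \<Rightarrow> (real^2 \<Rightarrow> real) \<Rightarrow>
    (element \<Rightarrow> real) \<Rightarrow> real^2 \<Rightarrow> real" where
  "u_coeff n GD GN f gN lam p =
     (\<Sum>q\<in>free_nodes n GD. matrix_inv_on (free_nodes n GD) (stiffness n lam) p q * load n GN f gN q)"

definition u_h :: "nat \<Rightarrow> (real^2) set \<Rightarrow> (real^2) set \<Rightarrow> (real^2 \<Rightarrow> real) \<Rightarrow> (real^2 \<Rightarrow> real) \<Rightarrow>
    (element \<Rightarrow> real) \<Rightarrow> real^2 \<Rightarrow> real" where
  "u_h n GD GN f gN lam x = (\<Sum>p\<in>free_nodes n GD. u_coeff n GD GN f gN lam p * hat n p x)"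

text \<open>\<open>\<nabla>u_h\<close> is constant in the interior of each element, so it can be evaluated at the centroid.\<close>

definition grad_u_h :: "nat \<Rightarrow> (real^2) set \<Rightarrow> (real^2) set \<Rightarrow> (real^2 \<Rightarrow> real) \<Rightarrow> (real^2 \<Rightarrow> real) \<Rightarrow>
    (element \<Rightarrow> real) \<Rightarrow> element \<Rightarrow> real^2" where
  "grad_u_h n GD GN f gN lam l = grad (u_h n GD GN f gN lam) (centroid n l)"

definition compliance :: "nat \<Rightarrow> (real^2) set \<Rightarrow> (real^2) set \<Rightarrow> (real^2 \<Rightarrow> real) \<Rightarrow> (real^2 \<Rightarrow> real) \<Rightarrow>
    (element \<Rightarrow> real) \<Rightarrow> real" where
  "compliance n GD GN f gN lam =
     (\<Sum>p\<in>free_nodes n GD. load n GN f gN p * u_coeff n GD GN f gN lam p)"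

section \<open>Truncated domain, sectors and sector values\<close>

text \<open>\<open>M\<close> is the mesh of the truncated domain around the reference triangle of type \<open>s\<close>.  The
  radius plays no role beyond this mesh, because the domain is the polygon covered by \<open>M\<close>.\<close>

definition truncated_mesh :: "ttype \<Rightarrow> (real^2) set set \<Rightarrow> bool" where
  "truncated_mesh s M \<longleftrightarrow> conforming_mesh M \<and> connected (mesh_domain M) \<and>
     ref_triangle s \<in> M \<and> ref_triangle s \<subseteq> mesh_domain M"

text \<open>Barycentric coordinates of the incenter are proportional to the lengths of the opposite
  sides.  Indices of type \<open>3\<close> are cyclic (\<open>3 + 1 = 1\<close>).\<close>

definition incenter :: "ttype \<Rightarrow> real^2" where
  "incenter s = (1 / (\<Sum>j\<in>UNIV. dist (ref_vertex s $ (j + 1)) (ref_vertex s $ (j + 2)))) *\<^sub>R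
     (\<Sum>j\<in>UNIV. dist (ref_vertex s $ (j + 1)) (ref_vertex s $ (j + 2)) *\<^sub>R ref_vertex s $ j)"

text \<open>Sector \<open>j\<close> lies between the rays from the incenter through the two vertices other than vertex
  \<open>j\<close>; each ray is assigned to just one of its two neighbouring sectors.\<close>

definition sector :: "ttype \<Rightarrow> (real^2) set set \<Rightarrow> 3 \<Rightarrow> (real^2) set" where
  "sector s M j = (mesh_domain M - ref_triangle s) \<inter>
     {incenter s + a *\<^sub>R (ref_vertex s $ (j + 1) - incenter s) + b *\<^sub>R (ref_vertex s $ (j + 2) - incenter s)
       | a b. 0 < a \<and> 0 \<le> b}"

definition neighbors :: "nat \<Rightarrow> element \<Rightarrow> element set" where
  "neighbors n l = {k \<in> elements n. vertices (triangle n k) \<inter> vertices (triangle n l) \<noteq> {}}"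

definition rescaled_triangle :: "nat \<Rightarrow> element \<Rightarrow> element \<Rightarrow> (real^2) set" where
  "rescaled_triangle n l k = (\<lambda>x. real n *\<^sub>R (x - centroid n l)) ` triangle n k"

definition sector_weight :: "nat \<Rightarrow> (ttype \<Rightarrow> (real^2) set set) \<Rightarrow> element \<Rightarrow> 3 \<Rightarrow> element \<Rightarrow> real" where
  "sector_weight n M l j k =
     measure lebesgue (rescaled_triangle n l k \<inter> sector (elem_type l) (M (elem_type l)) j) /
     measure lebesgue (rescaled_triangle n l k)"

definition sector_power_sum :: "nat \<Rightarrow> (ttype \<Rightarrow> (real^2) set set) \<Rightarrow> real \<Rightarrow> (element \<Rightarrow> real) \<Rightarrow>
    element \<Rightarrow> 3 \<Rightarrow> real" where
  "sector_power_sum n M \<alpha> lam l j = (\<Sum>k\<in>neighbors n l. sector_weight n M l j k * lam k powr \<alpha>)"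

text \<open>The sector values are assumed positive and given by the power mean wherever that is well
  defined.  The restriction matters: if an edge of \<open>T\<^sub>l\<close> lies on the boundary of the square,
  the sector beyond this edge contains no part of any mesh triangle, the power sum is 0, and the
  formula gives no positive number.  Such a sector may carry any positive value.\<close>

definition sector_values :: "nat \<Rightarrow> (ttype \<Rightarrow> (real^2) set set) \<Rightarrow> real \<Rightarrow> (element \<Rightarrow> real) \<Rightarrow>
    (element \<Rightarrow> real^3) \<Rightarrow> bool" where
  "sector_values n M \<alpha> lam lamS \<longleftrightarrow> (\<forall>l\<in>elements n. \<forall>j.
     0 < lamS l $ j \<and>
     (0 < sector_power_sum n M \<alpha> lam l j \<longrightarrow>
        lamS l $ j = sector_power_sum n M \<alpha> lam l j powr (1 / \<alpha>)))"

section \<open>Discrete correctors and the two models\<close>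

text \<open>\<open>\<Lambda> = (a, \<sigma>)\<close> consists of the material value \<open>a\<close> of the element and its sector values \<open>\<sigma>\<close>.\<close>

definition coefficient :: "ttype \<Rightarrow> (real^2) set set \<Rightarrow> real \<Rightarrow> real^3 \<Rightarrow> real^2 \<Rightarrow> real" where
  "coefficient s M c \<sigma> x =
     indicator (ref_triangle s) x * c + (\<Sum>j\<in>UNIV. indicator (sector s M j) x * \<sigma> $ j)"

definition corrector_K :: "ttype \<Rightarrow> (real^2) set set \<Rightarrow> real \<times> (real^3) \<Rightarrow> real \<Rightarrow> real^2 \<Rightarrow> real^2 \<Rightarrow> real" where
  "corrector_K s M \<Lambda> \<eta> e = (THE v. v \<in> P1_space_zero M \<and> (\<forall>\<psi>\<in>P1_space_zero M.
     (LINT x:mesh_domain M|lebesgue. coefficient s M \<eta> (snd \<Lambda>) x * (grad v x \<bullet> grad \<psi> x))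
       = - (\<eta> - fst \<Lambda>) * (LINT x:ref_triangle s|lebesgue. e \<bullet> grad \<psi> x)))"

definition corrector_W :: "ttype \<Rightarrow> (real^2) set set \<Rightarrow> real \<times> (real^3) \<Rightarrow> real^2 \<Rightarrow> real^2 \<Rightarrow> real" where
  "corrector_W s M \<Lambda> e = (THE v. v \<in> P1_space_zero M \<and> (\<forall>\<psi>\<in>P1_space_zero M.
     (LINT x:mesh_domain M|lebesgue. coefficient s M (fst \<Lambda>) (snd \<Lambda>) x * (grad v x \<bullet> grad \<psi> x))
       = - (LINT x:ref_triangle s|lebesgue. e \<bullet> grad \<psi> x)))"

definition mean_grad :: "ttype \<Rightarrow> (real^2 \<Rightarrow> real) \<Rightarrow> real^2" where
  "mean_grad s v = (1 / measure lebesgue (ref_triangle s)) *\<^sub>R (LINT x:ref_triangle s|lebesgue. grad v x)"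

text \<open>The vectors \<^term>\<open>axis k 1\<close> are the unit vectors; \<open>k\<close> is the column index.\<close>

definition P_matrix :: "ttype \<Rightarrow> (real^2) set set \<Rightarrow> real \<times> (real^3) \<Rightarrow> real \<Rightarrow> real^2^2" where
  "P_matrix s M \<Lambda> \<eta> = (\<chi> i k. mean_grad s (corrector_K s M \<Lambda> \<eta> (axis k 1)) $ i)"

definition \<Gamma>_matrix :: "ttype \<Rightarrow> (real^2) set set \<Rightarrow> real \<times> (real^3) \<Rightarrow> real^2^2" where
  "\<Gamma>_matrix s M \<Lambda> = (\<chi> i k. mean_grad s (corrector_W s M \<Lambda> (axis k 1)) $ i)"

definition J_TDnum :: "nat \<Rightarrow> (real^2) set \<Rightarrow> (real^2) set \<Rightarrow> (real^2 \<Rightarrow> real) \<Rightarrow> (real^2 \<Rightarrow> real) \<Rightarrow>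
    (ttype \<Rightarrow> (real^2) set set) \<Rightarrow> (element \<Rightarrow> real) \<Rightarrow> (element \<Rightarrow> real^3) \<Rightarrow>
    (element \<Rightarrow> real) \<Rightarrow> real" where
  "J_TDnum n GD GN f gN M lam lamS \<eta> =
     compliance n GD GN f gN lam - (\<Sum>l\<in>elements n.
       measure lebesgue (triangle n l) * (\<eta> l - lam l) *
       (grad_u_h n GD GN f gN lam l \<bullet>
         ((mat 1 + P_matrix (elem_type l) (M (elem_type l)) (lam l, lamS l) (\<eta> l))
            *v grad_u_h n GD GN f gN lam l)))"

definition J_SMWapprox :: "nat \<Rightarrow> (real^2) set \<Rightarrow> (real^2) set \<Rightarrow> (real^2 \<Rightarrow> real) \<Rightarrow> (real^2 \<Rightarrow> real) \<Rightarrow>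
    (ttype \<Rightarrow> (real^2) set set) \<Rightarrow> (element \<Rightarrow> real) \<Rightarrow> (element \<Rightarrow> real^3) \<Rightarrow>
    (element \<Rightarrow> real) \<Rightarrow> real" where
  "J_SMWapprox n GD GN f gN M lam lamS \<eta> =
     compliance n GD GN f gN lam - (\<Sum>l\<in>elements n.
       measure lebesgue (triangle n l) * (\<eta> l - lam l) *
       (grad_u_h n GD GN f gN lam l \<bullet>
         (matrix_inv (mat 1 - (\<eta> l - lam l) *\<^sub>R
              \<Gamma>_matrix (elem_type l) (M (elem_type l)) (lam l, lamS l))
            *v grad_u_h n GD GN f gN lam l)))"

end

theory Submission
  imports Defs
begin

text \<open>Both correctors lie in the same finite-dimensional space, and their bilinear forms for the
  coefficients \<open>\<eta>\<close> and \<open>\<lambda>\<close> in the reference triangle \<open>T\<close> differ only by \<open>(\<eta> - \<lambda>) \<integral>\<^sub>T \<nabla>v \<bullet> \<nabla>\<psi>\<close>.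
  Gradients are constant on \<open>T\<close>, so moving this term to the right-hand side shows that \<open>K[e]\<close> solves
  the problem of \<open>W\<close> with data \<open>(\<eta> - \<lambda>) (e + \<nabla>K[e])\<close>.  By linearity and unique solvability,
  \<open>P = (\<eta> - \<lambda>) \<Gamma> (I + P)\<close>, which says \<open>(I - (\<eta> - \<lambda>) \<Gamma>) (I + P) = I\<close>.\<close>


section \<open>Riesz representation in spaces separated by finitely many points\<close>

text \<open>Gram-Schmidt along a finite set of separating points. Adding \<open>p\<close> to the set
  enlarges the subspace of functions vanishing at \<open>p\<close> by at most one dimension, and the
  form \<open>a\<close>, an inner product on \<open>V\<close>, allows that direction to be chosen
  orthogonal to the subspace. This yields solutions of the discrete problems without a basis of the
  finite element space.\<close>

lemma finite_representer:
  fixes V :: "('a \<Rightarrow> real) set" and a :: "('a \<Rightarrow> real) \<Rightarrow> ('a \<Rightarrow> real) \<Rightarrow> real"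
  assumes "finite P"
    and "(\<lambda>_. 0) \<in> V"
    and "\<And>u v c d. \<lbrakk>u \<in> V; v \<in> V\<rbrakk> \<Longrightarrow> (\<lambda>x. c * u x + d * v x) \<in> V"
    and "\<And>u v w c d. \<lbrakk>u \<in> V; v \<in> V; w \<in> V\<rbrakk> \<Longrightarrow> a (\<lambda>x. c * u x + d * v x) w = c * a u w + d * a v w"
    and "\<And>u v. a u v = a v u"
    and "\<And>v. \<lbrakk>v \<in> V; v \<noteq> (\<lambda>_. 0)\<rbrakk> \<Longrightarrow> 0 < a v v"
    and "\<And>u v c d. \<lbrakk>u \<in> V; v \<in> V\<rbrakk> \<Longrightarrow> L (\<lambda>x. c * u x + d * v x) = c * L u + d * L v"
    and "\<And>v. \<lbrakk>v \<in> V; \<forall>p\<in>P. v p = 0\<rbrakk> \<Longrightarrow> v = (\<lambda>_. 0)"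
  shows "\<exists>v\<in>V. \<forall>\<psi>\<in>V. a v \<psi> = L \<psi>"
  using assms
proof (induction P arbitrary: V L rule: finite_induct)
  case empty
  note zero = empty.prems(1) and a_lin = empty.prems(3) and L_lin = empty.prems(6)
  have "\<psi> = (\<lambda>_. 0)" if "\<psi> \<in> V" for \<psi>
    using empty.prems(7) that by auto
  moreover have "a (\<lambda>_. 0) (\<lambda>_. 0) = 0" "L (\<lambda>_. 0) = 0"
    using a_lin[OF zero zero zero, of 0 0] L_lin[OF zero zero, of 0 0] by auto
  ultimately show ?case
    using zero by metis
next
  case (insert p P)
  note zero = insert.prems(1) and lin = insert.prems(2) and a_lin = insert.prems(3)
    and sym = insert.prems(4) and pos = insert.prems(5) and L_lin = insert.prems(6)
    and sep = insert.prems(7)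
  define V' where "V' = {v \<in> V. v p = 0}"
  have sub: "v \<in> V" if "v \<in> V'" for v
    using that by (simp add: V'_def)
  have IH: "\<exists>v\<in>V'. \<forall>\<psi>\<in>V'. a v \<psi> = L' \<psi>"
    if "\<And>u v c d. \<lbrakk>u \<in> V; v \<in> V\<rbrakk> \<Longrightarrow> L' (\<lambda>x. c * u x + d * v x) = c * L' u + d * L' v" for L'
  proof (rule insert.IH[of V' L'])
    show "a (\<lambda>x. c * u x + d * v x) w = c * a u w + d * a v w" if "u \<in> V'" "v \<in> V'" "w \<in> V'" for u v w c d
      using a_lin that sub by blast
    show "a u v = a v u" for u v
      by (rule sym)
  qed (auto simp: V'_def zero lin pos that intro!: sep)
  show ?case
  proof (cases "V' = V")
    case True
    then show ?thesis using IH[of L] L_lin by blast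
  next
    case False
    then obtain w where w: "w \<in> V" "w p \<noteq> 0" by (auto simp: V'_def)
    have a_lin': "a w (\<lambda>x. c * u x + d * v x) = c * a w u + d * a w v" if "u \<in> V" "v \<in> V" "w \<in> V" for u v w c d
      using a_lin[OF that, of c d] sym by metis
    \<comment> \<open>\<open>w'\<close> is the orthogonal projection of \<open>w\<close> onto
      \<open>V'\<close>, obtained by representing the functional \<open>a w\<close>. The difference
      \<open>z\<close> below is then orthogonal to \<open>V'\<close> and still nonzero at
      \<open>p\<close>.\<close>
    obtain w' where w': "w' \<in> V'" "\<And>\<psi>. \<psi> \<in> V' \<Longrightarrow> a w' \<psi> = a w \<psi>"
      using IH[of "a w"] a_lin' w(1) by metis
    obtain v' where v': "v' \<in> V'" "\<And>\<psi>. \<psi> \<in> V' \<Longrightarrow> a v' \<psi> = L \<psi>"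
      using IH[of L] L_lin by metis
    define z where "z = (\<lambda>x. 1 * w x + (-1) * w' x)"
    have z: "z \<in> V" unfolding z_def using w(1) sub[OF w'(1)] by (rule lin)
    have zp: "z p \<noteq> 0" using w w' by (simp add: z_def V'_def)
    then have azz: "0 < a z z" using pos[OF z] by metis
    have orth: "a z \<psi> = 0" if "\<psi> \<in> V'" for \<psi>
      unfolding z_def using a_lin[OF w(1) sub[OF w'(1)] sub[OF that], of 1 "-1"] w'(2)[OF that] by simp
    \<comment> \<open>The component along \<open>z\<close> does not affect tests with
      \<open>V'\<close>; its factor is fixed by testing with \<open>z\<close> itself.\<close>
    define v where "v = (\<lambda>x. 1 * v' x + (L z / a z z) * z x)"
    have "v \<in> V" unfolding v_def using sub[OF v'(1)] z by (rule lin)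
    moreover have "a v \<psi> = L \<psi>" if \<psi>: "\<psi> \<in> V" for \<psi>
    proof -
      \<comment> \<open>With this factor \<open>\<psi> - t z\<close> vanishes at \<open>p\<close>,
        so every \<open>\<psi>\<close> splits into a part in \<open>V'\<close> and a multiple of
        \<open>z\<close>.\<close>
      define t where "t = \<psi> p / z p"
      define \<psi>' where "\<psi>' = (\<lambda>x. 1 * \<psi> x + (- t) * z x)"
      have \<psi>': "\<psi>' \<in> V'"
        using lin[OF \<psi> z, of 1 "-t"] zp by (simp add: V'_def \<psi>'_def t_def)
      have dec: "\<psi> = (\<lambda>x. 1 * \<psi>' x + t * z x)" by (simp add: \<psi>'_def)
      have av: "a v \<phi> = a v' \<phi> + (L z / a z z) * a z \<phi>" if "\<phi> \<in> V" for \<phi>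
        unfolding v_def using a_lin[OF sub[OF v'(1)] z that, of 1 "L z / a z z"] by simp
      have "a v \<psi> = a v \<psi>' + t * a v z"
        using a_lin'[OF sub[OF \<psi>'] z \<open>v \<in> V\<close>, of 1 t] dec by simp
      also have "\<dots> = L \<psi>' + t * L z"
        using av[OF sub[OF \<psi>']] av[OF z] v'(2)[OF \<psi>'] orth[OF \<psi>'] orth[OF v'(1)] azz
          sym[of v' z] by simp
      also have "\<dots> = L \<psi>"
        using L_lin[OF sub[OF \<psi>'] z, of 1 t] dec by simp
      finally show ?thesis .
    qed
    ultimately show ?thesis by blast
  qed
qed

section \<open>Gradients of piecewise linear functions\<close>

text \<open>One gradient per element instead of one per point, so that integrals become finite sums.
  The choice is determined only if \<open>v\<close> is affine on \<open>\<tau>\<close> and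
  \<open>\<tau>\<close> has interior points.\<close>

definition elem_grad :: "(real^2 \<Rightarrow> real) \<Rightarrow> (real^2) set \<Rightarrow> real^2" where
  "elem_grad v \<tau> = (SOME g. \<exists>c. \<forall>x\<in>\<tau>. v x = g \<bullet> x + c)"

text \<open>The affine formula holds in a neighbourhood of \<open>x\<close>, so it gives the
  derivative there; uniqueness of derivatives then resolves the description in
  \<open>grad\<close>.\<close>

lemma grad_eqI:
  assumes "x \<in> interior \<tau>" "\<forall>y\<in>\<tau>. v y = g \<bullet> y + c"
  shows "grad v x = g"
proof -
  have "((\<lambda>y. g \<bullet> y + c) has_derivative (\<lambda>h. h \<bullet> g)) (at x)"
    by (auto intro!: derivative_eq_intros simp: inner_commute)
  then have "GDERIV v x :> g"
    unfolding gderiv_def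
    by (rule has_derivative_transform_within_open[of _ _ _ _ "interior \<tau>"])
      (use assms interior_subset[of \<tau>] in auto)
  moreover have "D = g" if "GDERIV v x :> D" for D
  proof -
    have "(\<lambda>h. h \<bullet> D) = (\<lambda>h. h \<bullet> g)"
      using that \<open>GDERIV v x :> g\<close> unfolding gderiv_def by (rule has_derivative_unique)
    then show ?thesis by (metis inner_commute vector_eq_rdot)
  qed
  ultimately show ?thesis unfolding grad_def by blast
qed

lemma affine_linear_on_elem_grad:
  assumes "affine_linear_on \<tau> v"
  obtains c where "\<forall>x\<in>\<tau>. v x = elem_grad v \<tau> \<bullet> x + c"
proof -
  have "\<exists>g c. \<forall>x\<in>\<tau>. v x = g \<bullet> x + c"
    using assms unfolding affine_linear_on_def .
  from someI_ex[OF this] that show thesis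
    unfolding elem_grad_def by blast
qed

lemma grad_eq_elem_grad:
  assumes "affine_linear_on \<tau> v" "x \<in> interior \<tau>"
  shows "grad v x = elem_grad v \<tau>"
  using affine_linear_on_elem_grad[OF assms(1)] grad_eqI[OF assms(2)] by metis

lemma elem_grad_eqI:
  assumes "interior \<tau> \<noteq> {}" "\<forall>y\<in>\<tau>. v y = g \<bullet> y + c"
  shows "elem_grad v \<tau> = g"
proof -
  obtain x where x: "x \<in> interior \<tau>" using assms(1) by blast
  have "affine_linear_on \<tau> v" unfolding affine_linear_on_def using assms(2) by blast
  from grad_eq_elem_grad[OF this x] grad_eqI[OF x assms(2)] show ?thesis by simp
qed

lemma elem_grad_lincomb:
  assumes "interior \<tau> \<noteq> {}" "affine_linear_on \<tau> u" "affine_linear_on \<tau> v"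
  shows "elem_grad (\<lambda>x. c * u x + d * v x) \<tau> = c *\<^sub>R elem_grad u \<tau> + d *\<^sub>R elem_grad v \<tau>"
proof -
  obtain a b where "\<forall>x\<in>\<tau>. u x = elem_grad u \<tau> \<bullet> x + a" "\<forall>x\<in>\<tau>. v x = elem_grad v \<tau> \<bullet> x + b"
    using affine_linear_on_elem_grad assms(2,3) by metis
  then have "\<forall>x\<in>\<tau>. c * u x + d * v x = (c *\<^sub>R elem_grad u \<tau> + d *\<^sub>R elem_grad v \<tau>) \<bullet> x + (c * a + d * b)"
    by (simp add: inner_add_left algebra_simps)
  with assms(1) show ?thesis by (rule elem_grad_eqI)
qed

lemma affine_linear_on_lincomb:
  assumes "affine_linear_on \<tau> u" "affine_linear_on \<tau> v"
  shows "affine_linear_on \<tau> (\<lambda>x. c * u x + d * v x)"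
proof -
  obtain a b where "\<forall>x\<in>\<tau>. u x = elem_grad u \<tau> \<bullet> x + a" "\<forall>x\<in>\<tau>. v x = elem_grad v \<tau> \<bullet> x + b"
    using affine_linear_on_elem_grad assms by metis
  then have "\<forall>x\<in>\<tau>. c * u x + d * v x = (c *\<^sub>R elem_grad u \<tau> + d *\<^sub>R elem_grad v \<tau>) \<bullet> x + (c * a + d * b)"
    by (simp add: inner_add_left algebra_simps)
  then show ?thesis unfolding affine_linear_on_def by blast
qed

text \<open>The points of \<open>C\<close> lie in a level set of the affine function, which is
  convex and hence contains their hull.\<close>

lemma affine_linear_on_eq_0:
  assumes "affine_linear_on (convex hull C) v" "\<forall>p\<in>C. v p = 0" "x \<in> convex hull C"
  shows "v x = 0"
proof -
  obtain g c where gc: "\<forall>x\<in>convex hull C. v x = g \<bullet> x + c"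
    using assms(1) unfolding affine_linear_on_def by blast
  have "convex hull C \<subseteq> {x. g \<bullet> x = - c}"
  proof (rule hull_minimal)
    show "C \<subseteq> {x. g \<bullet> x = - c}"
    proof
      fix p assume "p \<in> C"
      then have "v p = g \<bullet> p + c" "v p = 0" using gc assms(2) hull_inc by metis+
      then show "p \<in> {x. g \<bullet> x = - c}" by simp
    qed
  qed (rule convex_hyperplane)
  then show ?thesis using gc assms(3) by fastforce
qed

lemma P1_space_zero_lincomb:
  assumes "u \<in> P1_space_zero M" "v \<in> P1_space_zero M"
  shows "(\<lambda>x. c * u x + d * v x) \<in> P1_space_zero M"
  using assms unfolding P1_space_zero_def P1_space_def
  by (auto intro!: continuous_intros affine_linear_on_lincomb)

lemma zero_in_P1_space_zero: "(\<lambda>_. 0) \<in> P1_space_zero M"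
  unfolding P1_space_zero_def P1_space_def affine_linear_on_def
  by (auto intro: exI[of _ 0])

section \<open>Integrals over conforming meshes\<close>

text \<open>Intersection with balls of integer radius reduces the claim to bounded convex sets. It
  serves the sector cones, which are unbounded and neither open nor closed.\<close>

lemma convex_imp_sets_lebesgue:
  fixes S :: "'a::euclidean_space set"
  assumes "convex S"
  shows "S \<in> sets lebesgue"
proof -
  have "S = (\<Union>n::nat. S \<inter> cball 0 (real n))"
    by (auto simp: real_arch_simple)
  moreover have "S \<inter> cball 0 (real n) \<in> sets lebesgue" for n
    by (intro fmeasurableD measurable_convex convex_Int assms convex_cball) (auto simp: bounded_Int)
  then have "(\<Union>n::nat. S \<inter> cball 0 (real n)) \<in> sets lebesgue"
    by (intro sets.countable_UN) auto
  ultimately show ?thesis by simp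
qed

lemma AE_notin_negligible: "negligible N \<Longrightarrow> AE x in lebesgue. x \<notin> N"
  by (simp add: negligible_iff_null_sets AE_not_in)

text \<open>Measurability of \<open>f\<close> is derived rather than assumed: Lebesgue measure is
  complete, so it passes from \<open>k\<close> to \<open>f\<close> across a null set. This suits
  \<open>grad\<close>, whose values on element edges are uncontrolled.\<close>

lemma set_integral_eq_const_AE:
  fixes k :: "'a::euclidean_space \<Rightarrow> real" and y :: "'b::euclidean_space"
  assumes A: "A \<in> sets lebesgue" and k: "set_integrable lebesgue A k"
    and eq: "AE x in lebesgue. x \<in> A \<longrightarrow> f x = k x *\<^sub>R y"
  shows "set_integrable lebesgue A f" "(LINT x:A|lebesgue. f x) = (LINT x:A|lebesgue. k x) *\<^sub>R y"
proof -
  have int: "integrable lebesgue (\<lambda>x. (indicator A x *\<^sub>R k x) *\<^sub>R y)"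
    using k unfolding set_integrable_def by (rule integrable_scaleR_left)
  have ae: "AE x in lebesgue. (indicator A x *\<^sub>R k x) *\<^sub>R y = indicator A x *\<^sub>R f x"
    using eq by eventually_elim (auto split: split_indicator)
  have m: "(\<lambda>x. indicator A x *\<^sub>R f x) \<in> borel_measurable lebesgue"
    using borel_measurable_AE[OF borel_measurable_integrable[OF int] ae] .
  show "set_integrable lebesgue A f"
    unfolding set_integrable_def using integrable_cong_AE_imp[OF int m] ae
    by (simp add: eq_commute)
  have "(LINT x:A|lebesgue. f x) = (LINT x|lebesgue. (indicator A x *\<^sub>R k x) *\<^sub>R y)"
    unfolding set_lebesgue_integral_def
    by (rule integral_cong_AE[OF m borel_measurable_integrable[OF int]]) (use ae in \<open>simp add: eq_commute\<close>)
  also have "\<dots> = (LINT x:A|lebesgue. k x) *\<^sub>R y"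
    using k unfolding set_lebesgue_integral_def set_integrable_def
    by (intro integral_scaleR_left) auto
  finally show "(LINT x:A|lebesgue. f x) = (LINT x:A|lebesgue. k x) *\<^sub>R y" .
qed

text \<open>A simplex of dimension 2 spans the plane, so its interior is its relative interior,
  which is nonempty.\<close>

lemma interior_simplex2_nonempty:
  fixes \<tau> :: "(real^2) set"
  assumes "2 simplex \<tau>"
  shows "interior \<tau> \<noteq> {}"
proof -
  have d: "aff_dim \<tau> = 2" using assms by (rule aff_dim_simplex)
  then have "affine hull \<tau> = UNIV" by (simp add: affine_hull_UNIV aff_dim_eq_full)
  then have "rel_interior \<tau> = interior \<tau>" by (rule rel_interior_interior)
  moreover have "\<tau> \<noteq> {}" using d by force
  ultimately show ?thesis
    using rel_interior_eq_empty[OF convex_simplex[OF assms]] by simp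
qed

text \<open>The intersection is a face of both triangles and, as they differ, a proper face of at
  least one. Proper faces avoid the interior.\<close>

lemma conforming_mesh_interiors_disjoint:
  assumes "conforming_mesh M" "\<tau> \<in> M" "\<tau>' \<in> M" "\<tau> \<noteq> \<tau>'"
  shows "interior \<tau> \<inter> interior \<tau>' = {}"
proof -
  have f: "(\<tau> \<inter> \<tau>') face_of \<tau>" "(\<tau> \<inter> \<tau>') face_of \<tau>'"
    using assms unfolding conforming_mesh_def triangulation_def by (metis Int_commute)+
  show ?thesis
  proof (cases "\<tau> \<inter> \<tau>' = \<tau>")
    case True
    then have "\<tau> \<inter> \<tau>' \<noteq> \<tau>'" using assms(4) by auto
    then show ?thesis
      using face_of_disjoint_interior[OF f(2)] interior_subset[of \<tau>] interior_subset[of \<tau>'] True by blast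
  next
    case False
    then show ?thesis
      using face_of_disjoint_interior[OF f(1)] interior_subset[of \<tau>] interior_subset[of \<tau>'] by blast
  qed
qed

lemma conforming_mesh_finite: "conforming_mesh M \<Longrightarrow> finite M"
  and conforming_mesh_simplex: "conforming_mesh M \<Longrightarrow> \<tau> \<in> M \<Longrightarrow> 2 simplex \<tau>"
  by (auto simp: conforming_mesh_def triangulation_def)

lemma conforming_mesh_compact: "conforming_mesh M \<Longrightarrow> compact (\<Union>M)"
  by (intro compact_Union conforming_mesh_finite) (auto intro: compact_simplex conforming_mesh_simplex)

text \<open>A point of the domain outside all element interiors lies on one of finitely many element
  frontiers, which are null sets.\<close>

lemma mesh_domain_AE_interiors:
  assumes "conforming_mesh M"
  shows "AE x in lebesgue. x \<in> mesh_domain M \<longleftrightarrow> x \<in> (\<Union>\<tau>\<in>M. interior \<tau>)"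
proof -
  have "negligible (\<Union>\<tau>\<in>M. frontier \<tau>)"
    using conforming_mesh_finite[OF assms] conforming_mesh_simplex[OF assms]
    by (intro negligible_Union) (auto intro!: negligible_convex_frontier convex_simplex)
  from AE_notin_negligible[OF this] show ?thesis
  proof eventually_elim
    case (elim x)
    show ?case
    proof
      assume "x \<in> mesh_domain M"
      then obtain \<tau> where "\<tau> \<in> M" "x \<in> \<tau>" using interior_subset by blast
      with elim show "x \<in> (\<Union>\<tau>\<in>M. interior \<tau>)"
        using closure_subset unfolding frontier_def by fastforce
    next
      assume "x \<in> (\<Union>\<tau>\<in>M. interior \<tau>)"
      then show "x \<in> mesh_domain M"
        using interior_mono by (metis UN_E Union_upper subsetD)
    qed
  qed
qed

text \<open>Each triangle is the closure of its interior. The equality lets values on the open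
  domain determine those on the whole mesh and places the frontier of the domain inside the
  mesh.\<close>

lemma closure_mesh_domain:
  assumes "conforming_mesh M"
  shows "closure (mesh_domain M) = \<Union>M"
proof
  show "closure (mesh_domain M) \<subseteq> \<Union>M"
    by (simp add: closure_minimal interior_subset compact_imp_closed conforming_mesh_compact[OF assms])
  show "\<Union>M \<subseteq> closure (mesh_domain M)"
  proof
    fix x assume "x \<in> \<Union>M"
    then obtain \<tau> where \<tau>: "\<tau> \<in> M" "x \<in> \<tau>" by blast
    have s: "2 simplex \<tau>" using conforming_mesh_simplex[OF assms \<tau>(1)] .
    have "closure (interior \<tau>) = closure \<tau>"
      using convex_closure_interior[OF convex_simplex[OF s] interior_simplex2_nonempty[OF s]] .
    then have "x \<in> closure (interior \<tau>)" using \<tau>(2) closure_subset by blast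
    moreover have "interior \<tau> \<subseteq> mesh_domain M" using \<tau>(1) by (simp add: Union_upper interior_mono)
    ultimately show "x \<in> closure (mesh_domain M)" using closure_mono by blast
  qed
qed


section \<open>The coefficient of the truncated problem\<close>

lemma numeral_3_cyclic: "(4::3) = 1" "(5::3) = 2"
  by simp_all

lemma sum_UNIV_3_shift: "sum f (UNIV::3 set) = f j + f (j + 1) + f (j + 2)"
  using exhaust_3[of j] by (auto simp: sum_3 numeral_3_cyclic add_ac)

lemma plus_3_cyclic: "(j::3) + 1 + 1 = j + 2" "(j::3) + 1 + 2 = j"
  using exhaust_3[of j] by auto

text \<open>Subtracting the largest admissible multiple of the relation \<open>(\<Sum>j. \<gamma> j *\<^sub>R (v j - I)) = 0\<close>
  from \<open>x - I = (\<Sum>j. \<beta> j *\<^sub>R (v j - I))\<close> makes one coefficient vanish and the others nonnegative.\<close>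

lemma barycentric_cone_cover:
  fixes v :: "3 \<Rightarrow> 'a::real_vector" and \<beta> \<gamma> :: "3 \<Rightarrow> real"
  assumes \<gamma>: "\<And>j. 0 < \<gamma> j" "sum \<gamma> UNIV = 1" "I = (\<Sum>j\<in>UNIV. \<gamma> j *\<^sub>R v j)"
    and \<beta>: "sum \<beta> UNIV = 1" "x = (\<Sum>j\<in>UNIV. \<beta> j *\<^sub>R v j)"
    and "x \<noteq> I"
  shows "\<exists>j a b. 0 < a \<and> 0 \<le> b \<and> x = I + a *\<^sub>R (v (j + 1) - I) + b *\<^sub>R (v (j + 2) - I)"
proof -
  have "\<exists>j. \<forall>i. \<beta> j / \<gamma> j \<le> \<beta> i / \<gamma> i"
    using ex_min_if_finite[of "range (\<lambda>j. \<beta> j / \<gamma> j)"] by (auto simp: not_less)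
  then obtain j where j: "\<And>i. \<beta> j / \<gamma> j \<le> \<beta> i / \<gamma> i" by blast
  define t where "t = \<beta> j / \<gamma> j"
  define \<alpha> where "\<alpha> i = \<beta> i - t * \<gamma> i" for i
  have \<alpha>j: "\<alpha> j = 0" using \<gamma>(1)[of j] by (simp add: \<alpha>_def t_def)
  have \<alpha>0: "0 \<le> \<alpha> i" for i
    using j[of i] \<gamma>(1)[of i] by (simp add: \<alpha>_def t_def[symmetric] pos_le_divide_eq)
  have "(\<Sum>i\<in>UNIV. \<alpha> i *\<^sub>R v i) = x - t *\<^sub>R I"
    unfolding \<alpha>_def \<gamma>(3) \<beta>(2)
    by (simp add: scaleR_diff_left sum_subtractf scaleR_sum_right)
  moreover have "sum \<alpha> UNIV = 1 - t"
    using \<gamma>(2) \<beta>(1) by (simp add: \<alpha>_def sum_subtractf sum_distrib_left[symmetric])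
  ultimately have "(\<Sum>i\<in>UNIV. \<alpha> i *\<^sub>R (v i - I)) = x - t *\<^sub>R I - (1 - t) *\<^sub>R I"
    by (simp add: scaleR_diff_right sum_subtractf scaleR_sum_left[symmetric])
  then have "x = I + (\<Sum>i\<in>UNIV. \<alpha> i *\<^sub>R (v i - I))"
    by (simp add: algebra_simps)
  then have x: "x = I + \<alpha> (j + 1) *\<^sub>R (v (j + 1) - I) + \<alpha> (j + 2) *\<^sub>R (v (j + 2) - I)"
    by (simp add: sum_UNIV_3_shift[of _ j] \<alpha>j add.assoc)
  show ?thesis
  proof (cases "\<alpha> (j + 1) = 0")
    \<comment> \<open>Here \<open>x\<close> lies on the ray through vertex \<open>j + 2\<close>. The
      first coefficient of a cone must be positive, so this ray belongs to the cone with index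
      \<open>j + 1\<close>, where it has second coefficient 0.\<close>
    case True
    then have "x = I + \<alpha> (j + 2) *\<^sub>R (v (j + 1 + 1) - I) + 0 *\<^sub>R (v (j + 1 + 2) - I)"
      using x by (simp add: plus_3_cyclic)
    moreover have "0 < \<alpha> (j + 2)"
      using x True \<open>x \<noteq> I\<close> \<alpha>0[of "j + 2"] by (cases "\<alpha> (j + 2) = 0") auto
    ultimately show ?thesis by blast
  next
    case False
    then have "0 < \<alpha> (j + 1)" using \<alpha>0[of "j + 1"] by simp
    then show ?thesis using x \<alpha>0[of "j + 2"] by blast
  qed
qed

text \<open>The witnesses are the barycentric coordinates: affine functions equal to 1 at one vertex
  and 0 at the other two. They may be negative, so all points of the plane are reached.\<close>

lemma ref_vertex_barycentric:
  "\<exists>\<beta>. sum \<beta> UNIV = 1 \<and> x = (\<Sum>j\<in>UNIV. \<beta> j *\<^sub>R ref_vertex s $ j)"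
proof (cases s)
  case Type1
  define \<beta> where "\<beta> = (\<lambda>j::3. if j = 1 then 1/3 - x $ 1 else if j = 2 then 1/3 + x $ 1 - x $ 2 else 1/3 + x $ 2)"
  have "sum \<beta> UNIV = 1 \<and> x = (\<Sum>j\<in>UNIV. \<beta> j *\<^sub>R ref_vertex s $ j)"
    using Type1 by (simp add: \<beta>_def sum_3 vec_eq_iff forall_2 field_simps)
  then show ?thesis by blast
next
  case Type2
  define \<beta> where "\<beta> = (\<lambda>j::3. if j = 1 then 1/3 + x $ 1 else if j = 2 then 1/3 - x $ 2 else 1/3 - x $ 1 + x $ 2)"
  have "sum \<beta> UNIV = 1 \<and> x = (\<Sum>j\<in>UNIV. \<beta> j *\<^sub>R ref_vertex s $ j)"
    using Type2 by (simp add: \<beta>_def sum_3 vec_eq_iff forall_2 field_simps)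
  then show ?thesis by blast
qed

lemma ref_vertex_distinct: "ref_vertex s $ (j + 1) \<noteq> ref_vertex s $ (j + 2)"
  using exhaust_3[of j] by (cases s) (auto simp: vec_eq_iff forall_2 numeral_3_cyclic)

text \<open>The weights are the normalized lengths of the opposite sides, positive because the
  vertices are distinct.\<close>

lemma incenter_barycentric:
  "\<exists>\<gamma>. (\<forall>j. 0 < \<gamma> j) \<and> sum \<gamma> UNIV = 1 \<and> incenter s = (\<Sum>j\<in>UNIV. \<gamma> j *\<^sub>R ref_vertex s $ j)"
proof -
  define d where "d j = dist (ref_vertex s $ (j + 1)) (ref_vertex s $ (j + 2))" for j
  have d: "0 < d j" for j using ref_vertex_distinct by (simp add: d_def)
  then have D: "0 < sum d UNIV" by (simp add: sum_pos)
  show ?thesis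
  proof (intro exI conjI allI)
    show "0 < d j / sum d UNIV" for j using d D by simp
    show "(\<Sum>j\<in>UNIV. d j / sum d UNIV) = 1" using D by (simp add: sum_divide_distrib[symmetric])
    show "incenter s = (\<Sum>j\<in>UNIV. (d j / sum d UNIV) *\<^sub>R ref_vertex s $ j)"
      unfolding incenter_def d_def[symmetric] by (simp add: scaleR_sum_right)
  qed
qed

lemma incenter_in_ref_triangle: "incenter s \<in> ref_triangle s"
proof -
  obtain \<gamma> where \<gamma>: "\<And>j. 0 < \<gamma> j" "sum \<gamma> UNIV = 1" "incenter s = (\<Sum>j\<in>UNIV. \<gamma> j *\<^sub>R ref_vertex s $ j)"
    using incenter_barycentric by blast
  show ?thesis
    unfolding ref_triangle_def \<gamma>(3)
    by (rule convex_sum) (auto simp: \<gamma>(2) less_imp_le[OF \<gamma>(1)] hull_inc)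
qed

text \<open>Every point except the incenter lies in one of the three cones, and the incenter lies in
  the triangle. Hence \<open>coefficient\<close> has no gap in the domain where it would be
  zero.\<close>

lemma sectors_cover:
  assumes "x \<in> mesh_domain M" "x \<notin> ref_triangle s"
  shows "\<exists>j. x \<in> sector s M j"
proof -
  obtain \<gamma> where \<gamma>: "\<And>j. 0 < \<gamma> j" "sum \<gamma> UNIV = 1" "incenter s = (\<Sum>j\<in>UNIV. \<gamma> j *\<^sub>R ref_vertex s $ j)"
    using incenter_barycentric by blast
  obtain \<beta> where \<beta>: "sum \<beta> UNIV = 1" "x = (\<Sum>j\<in>UNIV. \<beta> j *\<^sub>R ref_vertex s $ j)"
    using ref_vertex_barycentric by blast
  have "x \<noteq> incenter s" using assms(2) incenter_in_ref_triangle by blast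
  from barycentric_cone_cover[OF \<gamma> \<beta> this] assms show ?thesis
    unfolding sector_def by blast
qed

section \<open>Measurability, integrability and positivity of the coefficient\<close>

lemma ref_triangle_convex: "convex (ref_triangle s)"
  by (simp add: ref_triangle_def)

text \<open>The half-open cone is convex, hence measurable; the domain is open and the triangle
  convex.\<close>

lemma sector_sets_lebesgue: "sector s M j \<in> sets lebesgue"
proof -
  let ?u = "ref_vertex s $ (j + 1) - incenter s" and ?w = "ref_vertex s $ (j + 2) - incenter s"
  have "convex {incenter s + a *\<^sub>R ?u + b *\<^sub>R ?w | a b. 0 < a \<and> 0 \<le> b}" (is "convex ?C")
  proof (rule convexI)
    fix x y and p q :: real
    assume x: "x \<in> ?C" and y: "y \<in> ?C" and pq: "0 \<le> p" "0 \<le> q" "p + q = 1"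
    obtain a b where ab: "0 < a" "0 \<le> b" "x = incenter s + a *\<^sub>R ?u + b *\<^sub>R ?w"
      using x by blast
    obtain c d where cd: "0 < c" "0 \<le> d" "y = incenter s + c *\<^sub>R ?u + d *\<^sub>R ?w"
      using y by blast
    have "p *\<^sub>R x + q *\<^sub>R y = (p + q) *\<^sub>R incenter s + (p * a + q * c) *\<^sub>R ?u + (p * b + q * d) *\<^sub>R ?w"
      unfolding ab(3) cd(3) scaleR_add_left scaleR_add_right scaleR_scaleR by (simp only: add_ac)
    moreover have "0 < p * a + q * c"
    proof (cases "p = 0")
      case True
      then show ?thesis using pq cd(1) by simp
    next
      case False
      then show ?thesis using pq ab(1) cd(1) by (intro add_pos_nonneg) auto
    qed
    moreover have "0 \<le> p * b + q * d" using pq ab cd by simp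
    ultimately show "p *\<^sub>R x + q *\<^sub>R y \<in> ?C" unfolding pq(3) by auto
  qed
  then have "?C \<in> sets lebesgue" by (rule convex_imp_sets_lebesgue)
  moreover have "mesh_domain M \<in> sets lebesgue" by (simp add: lborelD)
  ultimately show ?thesis
    unfolding sector_def using convex_imp_sets_lebesgue[OF ref_triangle_convex] by (intro sets.Int sets.Diff)
qed

lemma set_integrable_coefficient:
  assumes "A \<in> lmeasurable"
  shows "set_integrable lebesgue A (coefficient s M c \<sigma>)"
proof -
  have *: "integrable lebesgue (\<lambda>x. indicator A x * (indicator S x * y))"
    if "S \<in> sets lebesgue" for S and y :: real
  proof -
    have "A \<inter> S \<in> lmeasurable" using assms that by (rule fmeasurable_Int_fmeasurable)
    then have "integrable lebesgue (\<lambda>x. indicator (A \<inter> S) x * y)"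
      by (intro integrable_mult_left) (auto simp: fmeasurable_def)
    then show ?thesis by (simp add: indicator_inter_arith mult.assoc)
  qed
  show ?thesis
    unfolding set_integrable_def coefficient_def real_scaleR_def distrib_left sum_distrib_left
    by (intro Bochner_Integration.integrable_add Bochner_Integration.integrable_sum *) (auto intro: sector_sets_lebesgue convex_imp_sets_lebesgue ref_triangle_convex)
qed

text \<open>The bound is the least of the four material values: by \<open>sectors_cover\<close> at
  least one of them contributes at each point, and no contribution is negative.\<close>

lemma coefficient_lower_bound:
  assumes "0 < c" "\<And>j. 0 < \<sigma> $ j"
  obtains \<kappa> where "0 < \<kappa>" "\<And>x. x \<in> mesh_domain M \<Longrightarrow> \<kappa> \<le> coefficient s M c \<sigma> x"
proof -
  define \<kappa> where "\<kappa> = Min (insert c (range (($) \<sigma>)))"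
  have "\<kappa> \<le> coefficient s M c \<sigma> x" if "x \<in> mesh_domain M" for x
  proof (cases "x \<in> ref_triangle s")
    case True
    have "\<kappa> \<le> c" by (simp add: \<kappa>_def)
    also have "\<dots> \<le> coefficient s M c \<sigma> x"
      using True assms by (simp add: coefficient_def sum_nonneg less_imp_le)
    finally show ?thesis .
  next
    case False
    then obtain j where j: "x \<in> sector s M j" using sectors_cover \<open>x \<in> mesh_domain M\<close> by blast
    have "\<kappa> \<le> \<sigma> $ j" unfolding \<kappa>_def by (rule Min_le) auto
    also have "\<dots> = indicator (sector s M j) x * \<sigma> $ j" using j by simp
    also have "\<dots> \<le> (\<Sum>j\<in>UNIV. indicator (sector s M j) x * \<sigma> $ j)"
      by (rule member_le_sum) (auto simp: assms less_imp_le)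
    also have "\<dots> = coefficient s M c \<sigma> x" using False by (simp add: coefficient_def)
    finally show ?thesis .
  qed
  moreover have "0 < \<kappa>" using assms by (auto simp: \<kappa>_def)
  ultimately show thesis using that by blast
qed

lemma coefficient_change:
  "coefficient s M c' \<sigma> x = coefficient s M c \<sigma> x + (c' - c) * indicator (ref_triangle s) x"
  by (simp add: coefficient_def algebra_simps)

section \<open>The discrete form of the corrector problems\<close>

text \<open>Sector rays may cut through an element, so the coefficient need not be constant on it.
  As the gradients are, only its integral over the element enters the bilinear form.\<close>

definition mesh_weight :: "ttype \<Rightarrow> (real^2) set set \<Rightarrow> real \<Rightarrow> real^3 \<Rightarrow> (real^2) set \<Rightarrow> real" where
  "mesh_weight s M c \<sigma> \<tau> = (LINT x:interior \<tau>|lebesgue. coefficient s M c \<sigma> x)"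

definition mesh_form :: "ttype \<Rightarrow> (real^2) set set \<Rightarrow> real \<Rightarrow> real^3 \<Rightarrow> (real^2 \<Rightarrow> real) \<Rightarrow> (real^2 \<Rightarrow> real) \<Rightarrow> real" where
  "mesh_form s M c \<sigma> v w = (\<Sum>\<tau>\<in>M. mesh_weight s M c \<sigma> \<tau> * (elem_grad v \<tau> \<bullet> elem_grad w \<tau>))"

locale corrector_mesh =
  fixes s :: ttype and M :: "(real^2) set set"
  assumes truncated: "truncated_mesh s M"
begin

section \<open>Reduction of the integrals to sums over elements\<close>

lemma conforming: "conforming_mesh M"
  using truncated by (simp add: truncated_mesh_def)

lemma simplex_interior_nonempty: "\<tau> \<in> M \<Longrightarrow> interior \<tau> \<noteq> {}"
  by (intro interior_simplex2_nonempty conforming_mesh_simplex[OF conforming])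

lemma interior_lmeasurable: "\<tau> \<in> M \<Longrightarrow> interior \<tau> \<in> lmeasurable"
  using compact_simplex[OF conforming_mesh_simplex[OF conforming]]
  by (intro lmeasurable_interior) (auto simp: compact_imp_bounded)

lemma affine_linear: "v \<in> P1_space_zero M \<Longrightarrow> \<tau> \<in> M \<Longrightarrow> affine_linear_on \<tau> v"
  by (auto simp: P1_space_zero_def P1_space_def)

lemma ref_triangle_in_mesh: "ref_triangle s \<in> M"
  using truncated by (simp add: truncated_mesh_def)

text \<open>Up to a null set the domain is the disjoint union of the element interiors, and on each
  of these both gradients are constant.\<close>

lemma LINT_mesh_form:
  assumes v: "v \<in> P1_space_zero M" and w: "w \<in> P1_space_zero M"
  shows "(LINT x:mesh_domain M|lebesgue. coefficient s M c \<sigma> x * (grad v x \<bullet> grad w x))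
    = mesh_form s M c \<sigma> v w"
proof -
  let ?f = "\<lambda>x. coefficient s M c \<sigma> x * (grad v x \<bullet> grad w x)" and ?U = "\<Union>\<tau>\<in>M. interior \<tau>"
  have loc: "set_integrable lebesgue (interior \<tau>) ?f"
    "(LINT x:interior \<tau>|lebesgue. ?f x) = mesh_weight s M c \<sigma> \<tau> * (elem_grad v \<tau> \<bullet> elem_grad w \<tau>)"
    if "\<tau> \<in> M" for \<tau>
  proof -
    have "AE x in lebesgue. x \<in> interior \<tau> \<longrightarrow> ?f x = coefficient s M c \<sigma> x *\<^sub>R (elem_grad v \<tau> \<bullet> elem_grad w \<tau>)"
      using grad_eq_elem_grad affine_linear[OF v that] affine_linear[OF w that] by simp
    note eq = set_integral_eq_const_AE[OF _ set_integrable_coefficient[OF interior_lmeasurable[OF that]] this]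
    show "set_integrable lebesgue (interior \<tau>) ?f" by (rule eq(1)) (simp add: lborelD)
    show "(LINT x:interior \<tau>|lebesgue. ?f x) = mesh_weight s M c \<sigma> \<tau> * (elem_grad v \<tau> \<bullet> elem_grad w \<tau>)"
      unfolding mesh_weight_def by (subst eq(2)) (simp_all add: lborelD)
  qed
  have sets: "interior \<tau> \<in> sets lebesgue" for \<tau> :: "(real^2) set" by (simp add: lborelD)
  have fin: "finite M" using conforming by (rule conforming_mesh_finite)
  have "set_integrable lebesgue ?U ?f"
    by (rule set_integrable_UN[OF fin]) (use loc sets in auto)
  then have U: "set_borel_measurable lebesgue ?U ?f"
    unfolding set_integrable_def set_borel_measurable_def by (rule borel_measurable_integrable)
  have ae: "AE x in lebesgue. x \<in> ?U \<longleftrightarrow> x \<in> mesh_domain M"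
    using mesh_domain_AE_interiors[OF conforming] by eventually_elim blast
  \<comment> \<open>The integrand is uncontrolled on element edges; its measurability over the
    domain is inherited from \<open>?U\<close>, which differs by a null set.\<close>
  have \<Omega>: "set_borel_measurable lebesgue (mesh_domain M) ?f"
    using U unfolding set_borel_measurable_def
    by (rule borel_measurable_AE) (use ae in \<open>eventually_elim, simp add: indicator_def\<close>)
  have "(LINT x:mesh_domain M|lebesgue. ?f x) = (LINT x:?U|lebesgue. ?f x)"
    by (rule set_integral_cong_set[OF U \<Omega> ae])
  also have "\<dots> = (\<Sum>\<tau>\<in>M. LINT x:interior \<tau>|lebesgue. ?f x)"
    by (rule set_integral_finite_Union[OF fin])
      (use loc(1) sets conforming_mesh_interiors_disjoint[OF conforming] in \<open>auto simp: disjoint_family_on_def\<close>)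
  finally show ?thesis unfolding mesh_form_def using loc(2) by simp
qed

lemma ref_triangle_AE_interior: "AE x in lebesgue. x \<in> ref_triangle s \<longrightarrow> x \<in> interior (ref_triangle s)"
  using AE_notin_negligible[OF negligible_convex_frontier[OF ref_triangle_convex[of s]]]
proof eventually_elim
  case (elim x)
  then show ?case using closure_subset unfolding frontier_def by blast
qed

lemma ref_triangle_lmeasurable: "ref_triangle s \<in> lmeasurable"
  using compact_simplex[OF conforming_mesh_simplex[OF conforming ref_triangle_in_mesh]]
  by (rule lmeasurable_compact)

lemma measure_interior_ref_triangle:
  "measure lebesgue (interior (ref_triangle s)) = measure lebesgue (ref_triangle s)"
  by (rule measure_interior)
    (use compact_simplex[OF conforming_mesh_simplex[OF conforming ref_triangle_in_mesh]]
      negligible_convex_frontier[OF ref_triangle_convex] in \<open>auto simp: compact_imp_bounded\<close>)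

lemma measure_interior_pos: "\<tau> \<in> M \<Longrightarrow> 0 < measure lebesgue (interior \<tau>)"
  using interior_lmeasurable simplex_interior_nonempty open_not_negligible[of "interior \<tau>"]
    negligible_iff_measure0 by (metis open_interior zero_less_measure_iff)

lemma LINT_ref_triangle_grad:
  assumes "v \<in> P1_space_zero M"
  shows "(LINT x:ref_triangle s|lebesgue. e \<bullet> grad v x) = measure lebesgue (ref_triangle s) * (e \<bullet> elem_grad v (ref_triangle s))"
    and "mean_grad s v = elem_grad v (ref_triangle s)"
proof -
  note m = ref_triangle_lmeasurable
  have one: "set_integrable lebesgue (ref_triangle s) (\<lambda>_. 1::real)"
    "(LINT x:ref_triangle s|lebesgue. (1::real)) = measure lebesgue (ref_triangle s)"
    using m by (auto simp: set_integrable_def set_integral_const fmeasurable_def)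
  have g: "AE x in lebesgue. x \<in> ref_triangle s \<longrightarrow> grad v x = elem_grad v (ref_triangle s)"
    using ref_triangle_AE_interior
    by eventually_elim (auto simp: grad_eq_elem_grad affine_linear[OF assms ref_triangle_in_mesh])
  have e: "AE x in lebesgue. x \<in> ref_triangle s \<longrightarrow> e \<bullet> grad v x = 1 *\<^sub>R (e \<bullet> elem_grad v (ref_triangle s))"
    using g by eventually_elim simp
  show "(LINT x:ref_triangle s|lebesgue. e \<bullet> grad v x) = measure lebesgue (ref_triangle s) * (e \<bullet> elem_grad v (ref_triangle s))"
    using set_integral_eq_const_AE(2)[OF fmeasurableD[OF m] one(1) e] one(2) by simp
  have "AE x in lebesgue. x \<in> ref_triangle s \<longrightarrow> grad v x = 1 *\<^sub>R elem_grad v (ref_triangle s)"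
    using g by eventually_elim simp
  from set_integral_eq_const_AE(2)[OF fmeasurableD[OF m] one(1) this] one(2)
    measure_interior_pos[OF ref_triangle_in_mesh]
  show "mean_grad s v = elem_grad v (ref_triangle s)"
    by (simp add: mean_grad_def measure_interior_ref_triangle)
qed

text \<open>The coefficient is bounded below by a positive constant and the element interior has
  positive area.\<close>

lemma mesh_weight_pos:
  assumes "\<tau> \<in> M" "0 < c" "\<And>j. 0 < \<sigma> $ j"
  shows "0 < mesh_weight s M c \<sigma> \<tau>"
proof -
  obtain \<kappa> where \<kappa>: "0 < \<kappa>" "\<And>x. x \<in> mesh_domain M \<Longrightarrow> \<kappa> \<le> coefficient s M c \<sigma> x"
    using coefficient_lower_bound[OF assms(2,3)] by blast
  have sub: "interior \<tau> \<subseteq> mesh_domain M"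
    using assms(1) by (simp add: Union_upper interior_mono)
  note m = interior_lmeasurable[OF assms(1)]
  have "0 < measure lebesgue (interior \<tau>) * \<kappa>" using measure_interior_pos[OF assms(1)] \<kappa>(1) by simp
  also have "\<dots> = (LINT x:interior \<tau>|lebesgue. \<kappa>)"
    using m by (subst set_integral_const) (auto simp: fmeasurable_def)
  also have "\<dots> \<le> mesh_weight s M c \<sigma> \<tau>"
    unfolding mesh_weight_def
  proof (rule set_integral_mono)
    show "set_integrable lebesgue (interior \<tau>) (\<lambda>_. \<kappa>)"
      using m by (simp add: set_integrable_def fmeasurable_def)
  qed (use m \<kappa>(2) sub in \<open>auto simp: set_integrable_coefficient\<close>)
  finally show ?thesis .
qed

text \<open>The two coefficients differ only on the reference triangle, and the interior of any
  other element meets that triangle at most in its frontier, a null set.\<close>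

lemma mesh_weight_change:
  assumes "\<tau> \<in> M"
  shows "mesh_weight s M c' \<sigma> \<tau>
    = mesh_weight s M c \<sigma> \<tau> + (if \<tau> = ref_triangle s then (c' - c) * measure lebesgue (ref_triangle s) else 0)"
proof -
  let ?T = "ref_triangle s"
  note m = interior_lmeasurable[OF assms]
  have mi: "interior \<tau> \<inter> ?T \<in> lmeasurable"
    using m ref_triangle_lmeasurable by (rule fmeasurable.Int)
  have ind: "set_integrable lebesgue (interior \<tau>) (\<lambda>x. (c' - c) * indicator ?T x)"
    "(LINT x:interior \<tau>|lebesgue. indicator ?T x :: real) = measure lebesgue (interior \<tau> \<inter> ?T)"
    using mi unfolding set_integrable_def set_lebesgue_integral_def
    by (auto simp: indicator_inter_arith[symmetric] mult.left_commute[of _ "c' - c"] fmeasurable_def)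
  have "mesh_weight s M c' \<sigma> \<tau> = (LINT x:interior \<tau>|lebesgue. coefficient s M c \<sigma> x + (c' - c) * indicator ?T x)"
    unfolding mesh_weight_def
    by (rule set_lebesgue_integral_cong) (simp_all add: coefficient_change[of s M c' \<sigma> _ c] lborelD)
  also have "\<dots> = mesh_weight s M c \<sigma> \<tau> + (c' - c) * measure lebesgue (interior \<tau> \<inter> ?T)"
    unfolding mesh_weight_def set_integral_add(2)[OF set_integrable_coefficient[OF m] ind(1)] set_integral_mult_right ind(2) ..
  also have "measure lebesgue (interior \<tau> \<inter> ?T) = (if \<tau> = ?T then measure lebesgue ?T else 0)"
  proof (cases "\<tau> = ?T")
    case True
    then show ?thesis using measure_interior_ref_triangle by (simp add: Int_absorb2 interior_subset)
  next
    case False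
    have "interior \<tau> \<inter> ?T \<subseteq> frontier ?T"
      using conforming_mesh_interiors_disjoint[OF conforming assms ref_triangle_in_mesh False] closure_subset
      unfolding frontier_def by blast
    then have "negligible (interior \<tau> \<inter> ?T)"
      using negligible_convex_frontier[OF ref_triangle_convex] negligible_subset by blast
    then show ?thesis using False by (simp add: negligible_imp_measure0)
  qed
  finally show ?thesis by simp
qed

lemma mesh_form_change:
  "mesh_form s M c' \<sigma> v w = mesh_form s M c \<sigma> v w
    + (c' - c) * measure lebesgue (ref_triangle s) * (elem_grad v (ref_triangle s) \<bullet> elem_grad w (ref_triangle s))"
proof -
  have "mesh_form s M c' \<sigma> v w = (\<Sum>\<tau>\<in>M. mesh_weight s M c \<sigma> \<tau> * (elem_grad v \<tau> \<bullet> elem_grad w \<tau>)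
      + (if \<tau> = ref_triangle s then (c' - c) * measure lebesgue (ref_triangle s)
          * (elem_grad v (ref_triangle s) \<bullet> elem_grad w (ref_triangle s)) else 0))"
    unfolding mesh_form_def
    by (rule sum.cong) (auto simp: mesh_weight_change[of _ c' _ c] distrib_right)
  then show ?thesis
    using conforming_mesh_finite[OF conforming] ref_triangle_in_mesh
    by (simp add: sum.distrib mesh_form_def)
qed

section \<open>Positive definiteness and unique solvability\<close>

lemma mesh_form_lincomb_left:
  assumes "u \<in> P1_space_zero M" "v \<in> P1_space_zero M"
  shows "mesh_form s M c \<sigma> (\<lambda>x. a * u x + b * v x) w = a * mesh_form s M c \<sigma> u w + b * mesh_form s M c \<sigma> v w"
  unfolding mesh_form_def sum_distrib_left sum.distrib[symmetric]
  by (rule sum.cong)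
    (use assms in \<open>auto simp: elem_grad_lincomb simplex_interior_nonempty affine_linear inner_add_left algebra_simps\<close>)

lemma mesh_form_sym: "mesh_form s M c \<sigma> u v = mesh_form s M c \<sigma> v u"
  by (simp add: mesh_form_def inner_commute)

text \<open>Such a function is constant on each element, so it takes finitely many values on the
  domain. Being continuous on a connected set it is constant, and the boundary condition makes the
  constant zero.\<close>

lemma elem_grad_eq_0_imp_eq_0:
  assumes v: "v \<in> P1_space_zero M" and 0: "\<And>\<tau>. \<tau> \<in> M \<Longrightarrow> elem_grad v \<tau> = 0"
  shows "v = (\<lambda>_. 0)"
proof -
  let ?\<Omega> = "mesh_domain M"
  have cl: "closure ?\<Omega> = \<Union>M" using conforming by (rule closure_mesh_domain)
  have cont: "continuous_on (closure ?\<Omega>) v"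
    using v unfolding cl by (simp add: P1_space_zero_def P1_space_def)
  have "\<exists>c. \<forall>x\<in>\<tau>. v x = c" if "\<tau> \<in> M" for \<tau>
    using affine_linear_on_elem_grad[OF affine_linear[OF v that]] 0[OF that] by (metis add_0 inner_zero_left)
  then obtain c where c: "\<And>\<tau> x. \<tau> \<in> M \<Longrightarrow> x \<in> \<tau> \<Longrightarrow> v x = c \<tau>" by metis
  have "v ` \<Union>M \<subseteq> c ` M" using c by auto
  then have "finite (v ` ?\<Omega>)"
    using conforming_mesh_finite[OF conforming] interior_subset
    by (metis finite_imageI finite_subset image_mono)
  moreover have "connected ?\<Omega>" using truncated by (simp add: truncated_mesh_def)
  ultimately have "v constant_on ?\<Omega>"
    using cont closure_subset continuous_on_subset by (intro continuous_finite_range_constant) blast+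
  then obtain k where k: "\<And>x. x \<in> ?\<Omega> \<Longrightarrow> v x = k" unfolding constant_on_def by blast
  have k': "v x = k" if "x \<in> \<Union>M" for x
    using continuous_constant_on_closure[OF cont k] that cl by blast
  \<comment> \<open>A nonempty bounded subset of the plane has a frontier point, which is where the
    boundary condition can be evaluated.\<close>
  have "?\<Omega> \<noteq> {}"
    using cl ref_triangle_in_mesh simplex_interior_nonempty interior_subset by fastforce
  moreover have "bounded ?\<Omega>"
    using conforming_mesh_compact[OF conforming]    by (intro bounded_interior compact_imp_bounded)
  ultimately have "frontier ?\<Omega> \<noteq> {}"
    using frontier_not_empty not_bounded_UNIV by metis
  then obtain y where y: "y \<in> frontier ?\<Omega>" by blast
  then have "v y = 0" using v by (simp add: P1_space_zero_def)
  moreover have "y \<in> \<Union>M" using y cl unfolding frontier_def by blast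
  ultimately have "k = 0" using k' by simp
  \<comment> \<open>Equality as functions on the whole plane also uses the convention of extension
    by zero.\<close>
  moreover have "v x = 0" if "x \<notin> \<Union>M" for x
    using v that by (auto simp: P1_space_zero_def P1_space_def)
  ultimately show ?thesis using k' by blast
qed

lemma mesh_form_pos:
  assumes c: "0 < c" "\<And>j. 0 < \<sigma> $ j" and v: "v \<in> P1_space_zero M" "v \<noteq> (\<lambda>_. 0)"
  shows "0 < mesh_form s M c \<sigma> v v"
proof -
  obtain \<tau> where \<tau>: "\<tau> \<in> M" "elem_grad v \<tau> \<noteq> 0"
    using elem_grad_eq_0_imp_eq_0 v by blast
  have "0 < mesh_weight s M c \<sigma> \<tau> * (elem_grad v \<tau> \<bullet> elem_grad v \<tau>)"
    using mesh_weight_pos[OF \<tau>(1) c] \<tau>(2) by simp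
  moreover have "0 \<le> mesh_weight s M c \<sigma> \<tau> * (elem_grad v \<tau> \<bullet> elem_grad v \<tau>)" if "\<tau> \<in> M" for \<tau>
    using mesh_weight_pos[OF that c] by simp
  ultimately show ?thesis
    unfolding mesh_form_def by (rule sum_pos2[OF conforming_mesh_finite[OF conforming] \<tau>(1)])
qed

text \<open>The vertices of the finitely many triangles suffice, since an affine function is
  determined by them. This takes the place of finite dimension in
  \<open>finite_representer\<close>.\<close>

lemma separating_points:
  "\<exists>P. finite P \<and> (\<forall>v\<in>P1_space_zero M. (\<forall>p\<in>P. v p = 0) \<longrightarrow> v = (\<lambda>_. 0))"
proof -
  have "\<exists>C. finite C \<and> \<tau> = convex hull C" if "\<tau> \<in> M" for \<tau>
    using conforming_mesh_simplex[OF conforming that] unfolding simplex by blast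
  then obtain C where C: "\<And>\<tau>. \<tau> \<in> M \<Longrightarrow> finite (C \<tau>)" "\<And>\<tau>. \<tau> \<in> M \<Longrightarrow> \<tau> = convex hull C \<tau>"
    by metis
  have "v = (\<lambda>_. 0)" if v: "v \<in> P1_space_zero M" and 0: "\<forall>p\<in>(\<Union>\<tau>\<in>M. C \<tau>). v p = 0" for v
  proof
    fix x
    show "v x = 0"
    proof (cases "x \<in> \<Union>M")
      case True
      then obtain \<tau> where \<tau>: "\<tau> \<in> M" "x \<in> \<tau>" by blast
      show ?thesis
        by (rule affine_linear_on_eq_0[of "C \<tau>"]) (use affine_linear[OF v \<tau>(1)] C(2)[OF \<tau>(1)] \<tau> 0 in auto)
    next
      case False
      then show ?thesis using v by (auto simp: P1_space_zero_def P1_space_def)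
    qed
  qed
  moreover have "finite (\<Union>\<tau>\<in>M. C \<tau>)" using C(1) conforming_mesh_finite[OF conforming] by blast
  ultimately show ?thesis by blast
qed

lemma mesh_form_unique:
  assumes c: "0 < c" "\<And>j. 0 < \<sigma> $ j" and u: "u \<in> P1_space_zero M" and v: "v \<in> P1_space_zero M"
    and eq: "\<And>\<psi>. \<psi> \<in> P1_space_zero M \<Longrightarrow> mesh_form s M c \<sigma> u \<psi> = mesh_form s M c \<sigma> v \<psi>"
  shows "u = v"
proof -
  define z where "z = (\<lambda>x. 1 * u x + (-1) * v x)"
  have z: "z \<in> P1_space_zero M" unfolding z_def using u v by (rule P1_space_zero_lincomb)
  have "mesh_form s M c \<sigma> z z = 0"
    using mesh_form_lincomb_left[OF u v, of c \<sigma> 1 "-1" z] eq[OF z] unfolding z_def[symmetric] by simp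
  then have "z = (\<lambda>_. 0)" using mesh_form_pos[OF c z] by force
  then have "z x = 0" for x by simp
  then show ?thesis by (auto simp: z_def)
qed

text \<open>The factor \<open>r\<close> covers both corrector problems. Unique existence is what
  gives meaning to the definite descriptions in \<open>corrector_K\<close> and
  \<open>corrector_W\<close>.\<close>

lemma mesh_form_ex1:
  assumes c: "0 < c" "\<And>j. 0 < \<sigma> $ j"
  shows "\<exists>!v. v \<in> P1_space_zero M \<and> (\<forall>\<psi>\<in>P1_space_zero M.
    mesh_form s M c \<sigma> v \<psi> = r * (e \<bullet> elem_grad \<psi> (ref_triangle s)))"
proof -
  obtain P where P: "finite P" "\<And>v. v \<in> P1_space_zero M \<Longrightarrow> \<forall>p\<in>P. v p = 0 \<Longrightarrow> v = (\<lambda>_. 0)"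
    using separating_points by blast
  have "\<exists>v\<in>P1_space_zero M. \<forall>\<psi>\<in>P1_space_zero M.
      mesh_form s M c \<sigma> v \<psi> = r * (e \<bullet> elem_grad \<psi> (ref_triangle s))"
  proof (rule finite_representer[OF P(1)])
    show "(\<lambda>_. 0) \<in> P1_space_zero M" by (rule zero_in_P1_space_zero)
    show "mesh_form s M c \<sigma> u v = mesh_form s M c \<sigma> v u" for u v by (rule mesh_form_sym)
    fix u v w a b assume u: "u \<in> P1_space_zero M"
    show "u = (\<lambda>_. 0)" if "\<forall>p\<in>P. u p = 0" using P(2) u that by blast
    show "0 < mesh_form s M c \<sigma> u u" if "u \<noteq> (\<lambda>_. 0)" using mesh_form_pos c u that by blast
    assume v: "v \<in> P1_space_zero M"
    show "(\<lambda>x. a * u x + b * v x) \<in> P1_space_zero M" using u v by (rule P1_space_zero_lincomb)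
    show "mesh_form s M c \<sigma> (\<lambda>x. a * u x + b * v x) w = a * mesh_form s M c \<sigma> u w + b * mesh_form s M c \<sigma> v w"
      using u v by (rule mesh_form_lincomb_left)
    show "r * (e \<bullet> elem_grad (\<lambda>x. a * u x + b * v x) (ref_triangle s))
        = a * (r * (e \<bullet> elem_grad u (ref_triangle s))) + b * (r * (e \<bullet> elem_grad v (ref_triangle s)))"
      using u v by (simp add: elem_grad_lincomb simplex_interior_nonempty affine_linear ref_triangle_in_mesh
        inner_add_right algebra_simps)
  qed
  moreover have "u = v"
    if "u \<in> P1_space_zero M" "v \<in> P1_space_zero M"
      "\<forall>\<psi>\<in>P1_space_zero M. mesh_form s M c \<sigma> u \<psi> = r * (e \<bullet> elem_grad \<psi> (ref_triangle s))"
      "\<forall>\<psi>\<in>P1_space_zero M. mesh_form s M c \<sigma> v \<psi> = r * (e \<bullet> elem_grad \<psi> (ref_triangle s))" for u v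
    using mesh_form_unique[OF c that(1,2)] that(3,4) by simp
  ultimately show ?thesis by blast
qed

section \<open>The correctors and the matrix identity\<close>

lemma corrector_K:
  fixes e :: "real^2" and a \<eta> :: real
  assumes "0 < \<eta>" "\<And>j. 0 < \<sigma> $ j"
  defines "K \<equiv> corrector_K s M (a, \<sigma>) \<eta> e"
  shows "K \<in> P1_space_zero M"
    and "\<psi> \<in> P1_space_zero M \<Longrightarrow> mesh_form s M \<eta> \<sigma> K \<psi>
      = - (\<eta> - a) * measure lebesgue (ref_triangle s) * (e \<bullet> elem_grad \<psi> (ref_triangle s))"
proof -
  have "K = (THE v. v \<in> P1_space_zero M \<and> (\<forall>\<psi>\<in>P1_space_zero M. mesh_form s M \<eta> \<sigma> v \<psi>
      = - (\<eta> - a) * measure lebesgue (ref_triangle s) * (e \<bullet> elem_grad \<psi> (ref_triangle s))))"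
    unfolding K_def corrector_K_def fst_conv snd_conv
    \<comment> \<open>The integrals may be rewritten only for \<open>v\<close> in the space;
      \<open>conj_cong\<close> provides this from the first conjunct.\<close>
    by (rule arg_cong[of _ _ The], rule ext)
      (simp add: LINT_mesh_form LINT_ref_triangle_grad mult.assoc cong: conj_cong)
  then show "K \<in> P1_space_zero M"
    and "\<psi> \<in> P1_space_zero M \<Longrightarrow> mesh_form s M \<eta> \<sigma> K \<psi>
      = - (\<eta> - a) * measure lebesgue (ref_triangle s) * (e \<bullet> elem_grad \<psi> (ref_triangle s))"
    using theI'[OF mesh_form_ex1[OF assms(1,2), of "- (\<eta> - a) * measure lebesgue (ref_triangle s)" e]] by auto
qed

lemma corrector_W:
  fixes e :: "real^2" and a \<eta> :: real
  assumes "0 < a" "\<And>j. 0 < \<sigma> $ j"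
  defines "W \<equiv> corrector_W s M (a, \<sigma>) e"
  shows "W \<in> P1_space_zero M"
    and "\<psi> \<in> P1_space_zero M \<Longrightarrow> mesh_form s M a \<sigma> W \<psi>
      = - measure lebesgue (ref_triangle s) * (e \<bullet> elem_grad \<psi> (ref_triangle s))"
proof -
  have "W = (THE v. v \<in> P1_space_zero M \<and> (\<forall>\<psi>\<in>P1_space_zero M. mesh_form s M a \<sigma> v \<psi>
      = - measure lebesgue (ref_triangle s) * (e \<bullet> elem_grad \<psi> (ref_triangle s))))"
    unfolding W_def corrector_W_def fst_conv snd_conv
    by (rule arg_cong[of _ _ The], rule ext)
      (simp add: LINT_mesh_form LINT_ref_triangle_grad mult.assoc cong: conj_cong)
  then show "W \<in> P1_space_zero M"
    and "\<psi> \<in> P1_space_zero M \<Longrightarrow> mesh_form s M a \<sigma> W \<psi>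
      = - measure lebesgue (ref_triangle s) * (e \<bullet> elem_grad \<psi> (ref_triangle s))"
    using theI'[OF mesh_form_ex1[OF assms(1,2), of "- measure lebesgue (ref_triangle s)" e]] by auto
qed

text \<open>The identity is proved column by column: with the form for the value \<open>a\<close>,
  the corrector \<open>?K k\<close> solves a problem whose data are a constant vector on the
  triangle, so it is a linear combination of \<open>?W 1\<close> and \<open>?W 2\<close>.\<close>

lemma P_matrix_fixed_point:
  assumes a: "0 < a" and \<eta>: "0 < \<eta>" and \<sigma>: "\<And>j. 0 < \<sigma> $ j"
  shows "P_matrix s M (a, \<sigma>) \<eta>
    = (\<eta> - a) *\<^sub>R (\<Gamma>_matrix s M (a, \<sigma>) ** (mat 1 + P_matrix s M (a, \<sigma>) \<eta>))"
proof -
  let ?T = "ref_triangle s"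
  let ?K = "\<lambda>k. corrector_K s M (a, \<sigma>) \<eta> (axis k 1)"
  let ?W = "\<lambda>k. corrector_W s M (a, \<sigma>) (axis k 1)"
  note K = corrector_K[OF \<eta> \<sigma>] and W = corrector_W[OF a \<sigma>]
  have fixed_point: "elem_grad (?K k) ?T $ i = (\<eta> - a) * (\<Sum>j\<in>UNIV. elem_grad (?W j) ?T $ i * ((axis k 1 + elem_grad (?K k) ?T) $ j))"
    for i k :: 2
  proof -
    \<comment> \<open>\<open>g\<close> is column \<open>k\<close> of
      \<open>mat 1 + P_matrix s M (a, \<sigma>) \<eta>\<close>. It contains the gradient of
      \<open>?K k\<close>, so the representation below is implicit.\<close>
    define g where "g = axis k 1 + elem_grad (?K k) ?T"
    have "?K k = (\<lambda>x. ((\<eta> - a) * g $ 1) * ?W 1 x + ((\<eta> - a) * g $ 2) * ?W 2 x)" (is "_ = ?R")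
    proof (rule mesh_form_unique[OF a \<sigma>])
      show "?K k \<in> P1_space_zero M" by (rule K(1))
      show "?R \<in> P1_space_zero M" by (intro P1_space_zero_lincomb W(1))
      fix \<psi> assume \<psi>: "\<psi> \<in> P1_space_zero M"
      \<comment> \<open>Passing from the value \<open>\<eta>\<close> to \<open>a\<close> moves the
        gradient of \<open>?K k\<close> on the triangle to the right-hand side, where it joins the
        unit vector to form \<open>g\<close>.\<close>
      have "mesh_form s M a \<sigma> (?K k) \<psi> = - (\<eta> - a) * measure lebesgue ?T * (g \<bullet> elem_grad \<psi> ?T)"
        using K(2)[OF \<psi>, of a "axis k 1"] mesh_form_change[of \<eta> \<sigma> "?K k" \<psi> a]
        by (simp add: g_def inner_add_left algebra_simps)
      \<comment> \<open>Splitting \<open>g\<close> along the unit vectors turns the right-hand side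
        into a combination of those of \<open>?W 1\<close> and \<open>?W 2\<close>.\<close>
      also have "\<dots> = mesh_form s M a \<sigma> ?R \<psi>"
        unfolding mesh_form_lincomb_left[OF W(1) W(1)] W(2)[OF \<psi>]
        by (simp add: inner_vec_def[of g] sum_2 inner_axis' algebra_simps)
      finally show "mesh_form s M a \<sigma> (?K k) \<psi> = mesh_form s M a \<sigma> ?R \<psi>" .
    qed
    then have "elem_grad (?K k) ?T = elem_grad ?R ?T" by simp
    also have "\<dots> = ((\<eta> - a) * g $ 1) *\<^sub>R elem_grad (?W 1) ?T + ((\<eta> - a) * g $ 2) *\<^sub>R elem_grad (?W 2) ?T"
      by (intro elem_grad_lincomb simplex_interior_nonempty affine_linear ref_triangle_in_mesh W(1))
    finally have "elem_grad (?K k) ?T $ i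
      = (((\<eta> - a) * g $ 1) *\<^sub>R elem_grad (?W 1) ?T + ((\<eta> - a) * g $ 2) *\<^sub>R elem_grad (?W 2) ?T) $ i"
      by (rule arg_cong)
    then show ?thesis unfolding g_def[symmetric] by (simp add: sum_2 algebra_simps)
  qed
  have P: "P_matrix s M (a, \<sigma>) \<eta> $ i $ k = elem_grad (?K k) ?T $ i"
    and \<Gamma>: "\<Gamma>_matrix s M (a, \<sigma>) $ i $ k = elem_grad (?W k) ?T $ i" for i k
    by (simp_all add: P_matrix_def \<Gamma>_matrix_def LINT_ref_triangle_grad(2)[OF K(1)] LINT_ref_triangle_grad(2)[OF W(1)])
  have I_P: "(mat 1 + P_matrix s M (a, \<sigma>) \<eta>) $ j $ k = (axis k 1 + elem_grad (?K k) ?T) $ j" for j k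
    unfolding vector_add_component P by (simp add: mat_def axis_def)
  show ?thesis
    unfolding vec_eq_iff matrix_matrix_mult_def vector_scaleR_component real_scaleR_def vec_lambda_beta P \<Gamma> I_P
    by (intro allI fixed_point)
qed

text \<open>The fixed point equation says that \<open>?B\<close> is a right inverse of
  \<open>?A\<close>; for square matrices it is then two-sided. In particular \<open>?A\<close> is
  invertible without any smallness condition on \<open>\<eta> - a\<close>.\<close>

lemma matrix_inv_\<Gamma>:
  assumes "0 < a" "0 < \<eta>" "\<And>j. 0 < \<sigma> $ j"
  shows "matrix_inv (mat 1 - (\<eta> - a) *\<^sub>R \<Gamma>_matrix s M (a, \<sigma>)) = mat 1 + P_matrix s M (a, \<sigma>) \<eta>"
proof -
  let ?A = "mat 1 - (\<eta> - a) *\<^sub>R \<Gamma>_matrix s M (a, \<sigma>)" and ?B = "mat 1 + P_matrix s M (a, \<sigma>) \<eta>"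
  have "?A ** ?B = ?B - (\<eta> - a) *\<^sub>R (\<Gamma>_matrix s M (a, \<sigma>) ** ?B)"
    by (simp add: vec_eq_iff matrix_matrix_mult_def mat_def forall_2 sum_2 algebra_simps)
  also have "\<dots> = mat 1" using P_matrix_fixed_point[OF assms] by simp
  finally have AB: "?A ** ?B = mat 1" .
  then have BA: "?B ** ?A = mat 1" by (simp add: matrix_left_right_inverse)
  \<comment> \<open>\<open>matrix_inv\<close> chooses some two-sided inverse; \<open>?B\<close>
    shows that one exists, and associativity then identifies the chosen one with
    \<open>?B\<close>.\<close>
  have inv: "?A ** matrix_inv ?A = mat 1"
    unfolding matrix_inv_def by (rule someI2[of _ ?B]) (use AB BA in auto)
  have "matrix_inv ?A = ?B ** ?A ** matrix_inv ?A" by (simp add: BA)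
  also have "\<dots> = ?B" by (simp only: matrix_mul_assoc[symmetric] inv matrix_mul_rid)
  finally show ?thesis .
qed

end

theorem corollary6p2:
  fixes n :: nat and lo hi \<alpha> :: real
    and GD GN :: "(real^2) set" and f gN :: "real^2 \<Rightarrow> real"
    and M :: "ttype \<Rightarrow> (real^2) set set"
    and lam :: "element \<Rightarrow> real" and lamS :: "element \<Rightarrow> real^3"
  assumes "1 \<le> n" and "0 < lo" and "lo < hi" and "\<alpha> \<noteq> 0"
    and "GD \<inter> GN = {}" and "GD \<union> GN = frontier unit_square"
    and "boundary_measurable GD" and "boundary_length GD > 0"
    and "set_integrable lebesgue unit_square f" and "boundary_integrable GN gN"
    and "\<And>s. truncated_mesh s (M s)"
    and "\<forall>l\<in>elements n. lam l \<in> {lo..hi}"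
    and "sector_values n M \<alpha> lam lamS"
  shows "\<forall>\<eta>. (\<forall>l\<in>elements n. \<eta> l \<in> {lo..hi}) \<longrightarrow>
    J_TDnum n GD GN f gN M lam lamS \<eta> = J_SMWapprox n GD GN f gN M lam lamS \<eta>"
proof (intro allI impI)
  fix \<eta> :: "element \<Rightarrow> real"
  assume \<eta>: "\<forall>l\<in>elements n. \<eta> l \<in> {lo..hi}"
  \<comment> \<open>The remaining factors of the two sums are identical, so it suffices to compare
    these matrices for each element.\<close>
  have "matrix_inv (mat 1 - (\<eta> l - lam l) *\<^sub>R \<Gamma>_matrix (elem_type l) (M (elem_type l)) (lam l, lamS l))
      = mat 1 + P_matrix (elem_type l) (M (elem_type l)) (lam l, lamS l) (\<eta> l)"
    if l: "l \<in> elements n" for l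
  proof -
    interpret corrector_mesh "elem_type l" "M (elem_type l)"
      using assms(11) by unfold_locales
    have "0 < lam l" "0 < \<eta> l" using \<eta> assms(2,12) l by force+
    \<comment> \<open>Positivity is part of \<open>sector_values\<close> for every sector, including
      those beyond the boundary of the square, where the power sum is zero.\<close>
    moreover have "0 < lamS l $ j" for j using assms(13) l unfolding sector_values_def by blast
    ultimately show ?thesis by (rule matrix_inv_\<Gamma>)
  qed
  then show "J_TDnum n GD GN f gN M lam lamS \<eta> = J_SMWapprox n GD GN f gN M lam lamS \<eta>"
    unfolding J_TDnum_def J_SMWapprox_def by simp
qed

end
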